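(* Let $c\ge 1$, $s\ge 0$, $-1\le\alpha\le 1$, and let $(y(t),\dot y(t))$ be the exact solution of the finite-difference semidiscrete system $\ddot y=-\Omega^2y+f(y)$, satisfying $$\|y(t)\|^{new}_{s+1}+\|\dot y(t)\|^{new}_{s}\le M\qquad\text{for } 0\le t-t_0\le T .$$ Assume that Condition $A(\beta)$ holds with constant $c$ for $\beta=0$ and for $\beta=\alpha$. Let $(y^n,\dot y^n)$ be the numerical solution produced by the ERKN integrator with step size $h$ and starting values $y^0=y(t_0)$, $\dot y^0=\dot y(t_0)$. Then there exists $h_0>0$ such that for $0<h\le h_0$ $$\|y(t_n)-y^n\|^{new}_{s+1-\alpha}+\|\dot y(t_n)-\dot y^n\|^{new}_{s-\alpha}\le C h^{1+\alpha}\qquad\text{for } 0\le t_n-t_0=nh\le T,$$ where the constants $C$ and $h_0$ depend on $M$, $s$, $p$, $T$ and $c$.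
   Context: **Semidiscrete system (finite differences).** Let $p$ be a positive integer (the power in the wave equation $u_{tt}=u_{xx}+u^p$ with $2\pi$-periodic boundary conditions), $K\ge1$ an integer, $\mathcal K=\{-K,-K+1,\dots,K-1\}$ and $\Delta x=\pi/K$. Approximating $u_{xx}$ by second-order symmetric differences at the points $x_k=k\pi/K$ and writing $u(x_k,t)=\sum_{j\in\mathcal K}y_j(t)e^{\mathrm i jx_k}$ for $k\in\mathcal K$ gives, for $y(t)\in\mathbb C^{\mathcal K}$, the system $\ddot y(t)=-\Omega^2y(t)+f(y(t))$, where $\Omega=\mathrm{diag}(\omega_j)_{j\in\mathcal K}$ with $\omega_j=\frac{2}{\Delta x}\big|\sin\big(\frac{j\Delta x}{2}\big)\big|$, and $f(y)=y*\cdots*y$ ($p$ factors) with the discrete convolution $(y*z)_j=\sum_{k+l\equiv j \bmod 2K}y_kz_l$ ($k,l,j\in\mathcal K$). **Norm.** For $\sigma\in\mathbb R$ and $y\in\mathbb C^{\mathcal K}$, $\|y\|^{new}_\sigma=\big(\sum_{j\in\mathcal K}\max(\omega_j,\omega_{\min})^{2\sigma}|y_j|^2\big)^{1/2}$, where $\omega_{\min}$ is the minimal nonzero frequency among the $\omega_j$. **ERKN integrator.** Let $\mathrm{sinc}(x)=\sin(x)/x$, $\mathrm{sinc}(0)=1$, $h>0$ a step size, $V=h^2\Omega^2$, and let $\bar b_1,b_1$ be given scalar functions on $[0,\infty)$, with $\bar b_1(V)=\mathrm{diag}(\bar b_1(h^2\omega_j^2))$, $b_1(V)=\mathrm{diag}(b_1(h^2\omega_j^2))$.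 The one-stage explicit ERKN integrator (with $c_1=\tfrac12$) is $$y^{n+\frac12}=\cos(\tfrac12h\Omega)y^n+\tfrac12h\,\mathrm{sinc}(\tfrac12h\Omega)\dot y^n,$$ $$y^{n+1}=\cos(h\Omega)y^n+h\,\mathrm{sinc}(h\Omega)\dot y^n+h^2\bar b_1(V)f(y^{n+\frac12}),$$ $$\dot y^{n+1}=-\Omega\sin(h\Omega)y^n+\cos(h\Omega)\dot y^n+h\,b_1(V)f(y^{n+\frac12}).$$ Write $t_n=t_0+nh$. **Condition $A(\beta)$ with constant $c$** (for $-1\le\beta\le1$): for all $\xi=h\omega_j$ with $j\in\mathcal K$, $\omega_j\ne0$, $|\bar b_1(\xi^2)|\le c\,\xi^\beta$ if $-1\le\beta\le0$; $\ |\tfrac12\mathrm{sinc}^2(\xi/2)-\bar b_1(\xi^2)|\le c\,\xi^\beta$ if $0<\beta\le1$; and $|1-b_1(\xi^2)|\le c\,\xi^{1+\beta}$ in all cases.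
   Formalization: Since Condition A(β) says nothing at ω_j = 0 (with b_1(0) = 0 the claim fails for a solution in mode j = 0), it is additionally assumed that |b̄_1(0)| ≤ c, b_1(0) = 1, and b̄_1(0) = 1/2 if α > 0, as continuity at 0 with A(0), A(α) for all small h would give. *)

theory Defs
  imports "HOL-Probability.Sinc_Integral" "HOL-Number_Theory.Cong"
begin

text \<open>
  A vector of \<open>\<complex>\<close> to the power \<open>{-K, ..., K-1}\<close> is represented by a function
  \<open>int \<Rightarrow> complex\<close> of which only the values on \<open>modes K\<close> are ever used.
\<close>

definition modes :: "nat \<Rightarrow> int set" where
  "modes K = {- int K ..< int K}"

definition mesh :: "nat \<Rightarrow> real" where
  "mesh K = pi / real K"

definition omega :: "nat \<Rightarrow> int \<Rightarrow> real" where
  "omega K j = 2 / mesh K * \<bar>sin (of_int j * mesh K / 2)\<bar>"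

definition omega_min :: "nat \<Rightarrow> real" where
  "omega_min K = Min {omega K j | j. j \<in> modes K \<and> omega K j \<noteq> 0}"

definition norm_new :: "nat \<Rightarrow> real \<Rightarrow> (int \<Rightarrow> complex) \<Rightarrow> real" where
  "norm_new K \<sigma> y =
     sqrt (\<Sum>j\<in>modes K. max (omega K j) (omega_min K) powr (2 * \<sigma>) * (cmod (y j))\<^sup>2)"

definition dconv :: "nat \<Rightarrow> (int \<Rightarrow> complex) \<Rightarrow> (int \<Rightarrow> complex) \<Rightarrow> int \<Rightarrow> complex" where
  "dconv K y z j =
     (\<Sum>(k, l) | k \<in> modes K \<and> l \<in> modes K \<and> [k + l = j] (mod (2 * int K)). y k * z l)"

text \<open>The convolution of \<open>p\<close> factors \<open>y\<close>; meaningful for \<open>p \<ge> 1\<close>.\<close>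

definition nonlin :: "nat \<Rightarrow> nat \<Rightarrow> (int \<Rightarrow> complex) \<Rightarrow> int \<Rightarrow> complex" where
  "nonlin K p y = (dconv K y ^^ (p - 1)) y"

text \<open>
  The second-order system is written as a first-order system for the pair of \<open>y\<close> and its
  derivative \<open>v\<close>. The derivatives at the two end points of the time interval are one-sided.
\<close>

definition semidiscrete_solution ::
  "nat \<Rightarrow> nat \<Rightarrow> real \<Rightarrow> real \<Rightarrow> (real \<Rightarrow> int \<Rightarrow> complex) \<Rightarrow> (real \<Rightarrow> int \<Rightarrow> complex) \<Rightarrow> bool" where
  "semidiscrete_solution K p t0 T y v \<longleftrightarrow>
     (\<forall>t\<in>{t0..t0+T}. \<forall>j\<in>modes K.
        ((\<lambda>\<tau>. y \<tau> j) has_vector_derivative v t j) (at t within {t0..t0+T}) \<and>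
        ((\<lambda>\<tau>. v \<tau> j) has_vector_derivative
           (- of_real ((omega K j)\<^sup>2) * y t j + nonlin K p (y t) j)) (at t within {t0..t0+T}))"

definition erkn_half ::
  "nat \<Rightarrow> real \<Rightarrow> (int \<Rightarrow> complex) \<Rightarrow> (int \<Rightarrow> complex) \<Rightarrow> int \<Rightarrow> complex" where
  "erkn_half K h y v j =
     of_real (cos (h * omega K j / 2)) * y j + of_real (h / 2 * sinc (h * omega K j / 2)) * v j"

definition erkn_step ::
  "nat \<Rightarrow> nat \<Rightarrow> (real \<Rightarrow> real) \<Rightarrow> (real \<Rightarrow> real) \<Rightarrow> real \<Rightarrow>
   (int \<Rightarrow> complex) \<times> (int \<Rightarrow> complex) \<Rightarrow> (int \<Rightarrow> complex) \<times> (int \<Rightarrow> complex)" where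
  "erkn_step K p bbar1 b1 h = (\<lambda>(y, v).
     let F = nonlin K p (erkn_half K h y v) in
     ((\<lambda>j. of_real (cos (h * omega K j)) * y j
           + of_real (h * sinc (h * omega K j)) * v j
           + of_real (h\<^sup>2 * bbar1 (h\<^sup>2 * (omega K j)\<^sup>2)) * F j),
      (\<lambda>j. - of_real (omega K j * sin (h * omega K j)) * y j
           + of_real (cos (h * omega K j)) * v j
           + of_real (h * b1 (h\<^sup>2 * (omega K j)\<^sup>2)) * F j)))"

definition erkn ::
  "nat \<Rightarrow> nat \<Rightarrow> (real \<Rightarrow> real) \<Rightarrow> (real \<Rightarrow> real) \<Rightarrow> real \<Rightarrow>
   (int \<Rightarrow> complex) \<Rightarrow> (int \<Rightarrow> complex) \<Rightarrow> nat \<Rightarrow> (int \<Rightarrow> complex) \<times> (int \<Rightarrow> complex)" where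
  "erkn K p bbar1 b1 h y0 v0 n = (erkn_step K p bbar1 b1 h ^^ n) (y0, v0)"

definition condition_A ::
  "nat \<Rightarrow> real \<Rightarrow> real \<Rightarrow> real \<Rightarrow> (real \<Rightarrow> real) \<Rightarrow> (real \<Rightarrow> real) \<Rightarrow> bool" where
  "condition_A K h c \<beta> bbar1 b1 \<longleftrightarrow>
     (\<forall>j\<in>modes K. omega K j \<noteq> 0 \<longrightarrow>
        (let \<xi> = h * omega K j in
           (-1 \<le> \<beta> \<and> \<beta> \<le> 0 \<longrightarrow> \<bar>bbar1 (\<xi>\<^sup>2)\<bar> \<le> c * \<xi> powr \<beta>) \<and>
           (0 < \<beta> \<and> \<beta> \<le> 1 \<longrightarrow> \<bar>(sinc (\<xi> / 2))\<^sup>2 / 2 - bbar1 (\<xi>\<^sup>2)\<bar> \<le> c * \<xi> powr \<beta>) \<and>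
           \<bar>1 - b1 (\<xi>\<^sup>2)\<bar> \<le> c * \<xi> powr (1 + \<beta>)))"

text \<open>
  \<open>condition_A\<close> says nothing about the frequency \<open>0\<close>, whose coefficients \<open>bbar1 0\<close> and \<open>b1 0\<close>
  nevertheless enter the scheme (with \<open>b1 0 = 0\<close> the mean value of the velocity would never
  change, so there is no convergence at all). For coefficient functions that are continuous
  at \<open>0\<close>, letting \<open>\<xi>\<close> tend to \<open>0\<close> in the conditions for \<open>\<beta> = 0\<close> and \<open>\<beta> = \<alpha>\<close> gives exactly the
  following, as the lemma below shows.
\<close>

definition zero_frequency_limit :: "real \<Rightarrow> real \<Rightarrow> (real \<Rightarrow> real) \<Rightarrow> (real \<Rightarrow> real) \<Rightarrow> bool" where
  "zero_frequency_limit c \<alpha> bbar1 b1 \<longleftrightarrow>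
     \<bar>bbar1 0\<bar> \<le> c \<and> b1 0 = 1 \<and> (0 < \<alpha> \<longrightarrow> bbar1 0 = 1 / 2)"

lemma zero_frequency_limit_of_continuous:
  assumes K: "1 \<le> K" and h1: "0 < h1" and \<alpha>: "\<alpha> \<le> 1"
    and cont: "continuous (at 0 within {0..}) bbar1" "continuous (at 0 within {0..}) b1"
    and A: "\<And>h. 0 < h \<Longrightarrow> h \<le> h1 \<Longrightarrow> condition_A K h c 0 bbar1 b1"
           "\<And>h. 0 < h \<Longrightarrow> h \<le> h1 \<Longrightarrow> condition_A K h c \<alpha> bbar1 b1"
  shows "zero_frequency_limit c \<alpha> bbar1 b1"
proof -
  define w where "w = omega K (-1)"
  have "0 < pi / (2 * real K)" "pi / (2 * real K) < pi"
    using K by (auto simp: field_simps)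
  then have "0 < sin (pi / (2 * real K))" by (rule sin_gt_zero)
  then have w: "0 < w" using K by (simp add: w_def omega_def mesh_def field_simps)
  have j: "-1 \<in> modes K" using K by (simp add: modes_def)
  have ev: "\<forall>\<^sub>F h in at_right 0. 0 < h \<and> h \<le> h1"
    using eventually_at_right_less[of "0::real"] eventually_at_right_real[OF h1]
    by eventually_elim auto
  have hw: "((\<lambda>h. h * w) \<longlongrightarrow> 0) (at_right 0)"
    by (auto intro!: tendsto_eq_intros)
  have sq: "filterlim (\<lambda>h. (h * w)\<^sup>2) (at 0 within {0..}) (at_right 0)"
    unfolding filterlim_at using w hw
    by (auto intro!: tendsto_eq_intros eventually_mono[OF ev])
  have lim: "((\<lambda>h. b ((h * w)\<^sup>2)) \<longlongrightarrow> b 0) (at_right 0)"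
    if "continuous (at 0 within {0..}) b" for b :: "real \<Rightarrow> real"
    using filterlim_compose[OF that[unfolded continuous_within] sq] .
  have A0: "\<forall>\<^sub>F h in at_right 0. \<bar>bbar1 ((h * w)\<^sup>2)\<bar> \<le> c \<and> \<bar>1 - b1 ((h * w)\<^sup>2)\<bar> \<le> c * (h * w)"
    using ev
  proof eventually_elim
    case (elim h)
    then show ?case
      using A(1)[of h] j w unfolding condition_A_def Let_def w_def[symmetric]
      by (force dest!: bspec[of _ _ "-1"] simp: w_def[symmetric])
  qed
  have "\<bar>bbar1 0\<bar> \<le> c"
    by (rule tendsto_upperbound[OF tendsto_rabs[OF lim[OF cont(1)]]])
       (use A0 in \<open>auto elim: eventually_mono\<close>)
  moreover have "\<bar>1 - b1 0\<bar> \<le> 0"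
  proof (rule tendsto_le[of "at_right (0::real)"])
    show "((\<lambda>h. c * (h * w)) \<longlongrightarrow> 0) (at_right 0)"
      by (auto intro!: tendsto_eq_intros)
    show "((\<lambda>h. \<bar>1 - b1 ((h * w)\<^sup>2)\<bar>) \<longlongrightarrow> \<bar>1 - b1 0\<bar>) (at_right 0)"
      by (intro tendsto_intros lim cont)
  qed (use A0 in \<open>auto elim: eventually_mono\<close>)
  moreover have "bbar1 0 = 1 / 2" if "0 < \<alpha>"
  proof -
    have A\<alpha>: "\<forall>\<^sub>F h in at_right 0.
        \<bar>(sinc (h * w / 2))\<^sup>2 / 2 - bbar1 ((h * w)\<^sup>2)\<bar> \<le> c * (h * w) powr \<alpha>"
      using ev
    proof eventually_elim
      case (elim h)
      then show ?case
        using A(2)[of h] j w that \<alpha> unfolding condition_A_def Let_def w_def[symmetric]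
        by (force dest!: bspec[of _ _ "-1"] simp: w_def[symmetric])
    qed
    have s: "((\<lambda>h. sinc (h * w / 2)) \<longlongrightarrow> sinc 0) (at_right 0)"
      by (rule isCont_tendsto_compose[OF isCont_sinc]) (auto intro!: tendsto_eq_intros)
    have "\<bar>(sinc 0)\<^sup>2 / 2 - bbar1 0\<bar> \<le> 0"
    proof (rule tendsto_le[of "at_right (0::real)"])
      have "((\<lambda>h. (h * w) powr \<alpha>) \<longlongrightarrow> 0 powr \<alpha>) (at_right 0)"
        using ev w that by (intro tendsto_powr2 hw) (auto elim!: eventually_mono)
      from tendsto_mult[OF tendsto_const[of c] this]
      show "((\<lambda>h. c * (h * w) powr \<alpha>) \<longlongrightarrow> 0) (at_right 0)"
        by simp
      show "((\<lambda>h. \<bar>(sinc (h * w / 2))\<^sup>2 / 2 - bbar1 ((h * w)\<^sup>2)\<bar>)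
          \<longlongrightarrow> \<bar>(sinc 0)\<^sup>2 / 2 - bbar1 0\<bar>) (at_right 0)"
        by (rule tendsto_rabs[OF tendsto_diff[OF tendsto_divide[OF tendsto_power[OF s]
              tendsto_const] lim[OF cont(1)]]]) simp
    qed (use A\<alpha> in auto)
    then show ?thesis by simp
  qed
  ultimately show ?thesis unfolding zero_frequency_limit_def by auto
qed

end

theory Submission
  imports Defs
begin

text \<open>
  The proof is an error recursion for the integrator in the energy norm of orders \<open>s + 1 - \<alpha>\<close> for
  positions and \<open>s - \<alpha>\<close> for velocities. All constants are explicit and independent of \<open>K\<close>.

  Uniformity in \<open>K\<close> rests on three properties of the weights (the frequencies, with \<open>0\<close> replaced by
  the smallest nonzero one): they are at least \<open>1 / 2\<close>, the sum of their inverse squares is bounded, and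
  they are subadditive modulo \<open>2 * K\<close>. They give product estimates for the discrete convolution as in
  periodic Sobolev spaces: multiplication by a vector of order \<open>s + 1\<close> is bounded at each order of
  modulus at most \<open>s + 1\<close> (\<open>norm_new_dconv_smooth_right\<close>), and products of vectors of order \<open>s\<close> have order
  \<open>s - 1\<close> (\<open>norm_new_dconv_one_less\<close>). Hence the nonlinearity is bounded and Lipschitz continuous on
  balls of order \<open>s + 1\<close>, and its second differences at order \<open>s - 1\<close> are controlled by those of its
  argument (\<open>norm_new_conv_power_second_diff\<close>).

  Local error: by the variation of constants formula the defect of the exact solution splits into
  the error of freezing the nonlinearity at the stage and the deviation of the coefficients from
  \<open>sinc\<^sup>2 / 2\<close> and \<open>1\<close>. The second part is of order \<open>h powr (2 + \<alpha>)\<close> by the hypothesis on the coefficients,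
  read as a multiplier bound (\<open>norm_new_multiplier\<close>). For the first part the exact solution has regularity
  \<open>s + 1\<close>, \<open>s\<close> and \<open>s - 1\<close> in its value and first two derivatives, so that first differences are of size
  \<open>h\<close> at order \<open>s\<close> and symmetric second differences of size \<open>h\<^sup>2\<close> at order \<open>s - 1\<close>; interpolation between
  these orders (\<open>norm_new_interpolate\<close>) covers all \<open>\<alpha>\<close> (\<open>position_quadrature_error\<close>,
  \<open>velocity_quadrature_error\<close>).

  Stability: the linear flow grows at most by the factor \<open>1 + h\<close> in the energy norm
  (\<open>energy_norm_flow\<close>), and the nonlinear part of a step contributes a multiple of \<open>h\<close>
  (\<open>force_difference_energy_norm\<close>), provided that the stages of the numerical solution are bounded at
  order \<open>s + 1\<close>. This proviso is the statement that the error for \<open>\<alpha> = 0\<close> is small. Therefore the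
  recursion is solved first for \<open>\<alpha> = 0\<close>, by a bootstrap that determines \<open>h0\<close>, and then for the given
  \<open>\<alpha>\<close> (\<open>global_error\<close>).
\<close>

section \<open>Frequencies and weights\<close>

text \<open>
  A weak form of Jordan's inequality: it makes \<open>omega K j\<close> comparable with \<open>\<bar>j\<bar>\<close>, uniformly in \<open>K\<close>.
\<close>

lemma half_le_sin:
  fixes x :: real
  assumes "0 \<le> x" "x \<le> pi / 2"
  shows "x / 2 \<le> sin x"
proof -
  define u where "u = x / 2"
  have u: "0 \<le> u" "u \<le> pi / 4" using assms by (auto simp: u_def)
  have sc: "u * cos u \<le> sin u"
  proof -
    have "(\<lambda>t. sin t - t * cos t) 0 \<le> (\<lambda>t. sin t - t * cos t) u"
    proof (rule DERIV_nonneg_imp_nondecreasing[OF u(1)])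
      fix t :: real assume t: "0 \<le> t" "t \<le> u"
      have "((\<lambda>t. sin t - t * cos t) has_real_derivative t * sin t) (at t)"
        by (auto intro!: derivative_eq_intros)
      moreover have "0 \<le> t * sin t"
        using t u by (intro mult_nonneg_nonneg sin_ge_zero) auto
      ultimately show "\<exists>y. ((\<lambda>t. sin t - t * cos t) has_real_derivative y) (at t) \<and> 0 \<le> y"
        by blast
    qed
    then show ?thesis by simp
  qed
  \<comment> \<open>With \<open>u = x / 2\<close>: \<open>sin x = 2 * sin u * cos u \<ge> x * (cos u)\<^sup>2 = x * (1 + cos x) / 2\<close>.\<close>
  have "0 \<le> cos u" "0 \<le> cos x"
    using u assms by (auto intro!: cos_ge_zero simp: u_def)
  have "x / 2 \<le> x * (1 + cos x) / 2"
    using assms \<open>0 \<le> cos x\<close> by (simp add: field_simps)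
  also have "\<dots> = 2 * (u * cos u) * cos u"
    using cos_double_cos[of u] by (simp add: u_def power2_eq_square field_simps)
  also have "\<dots> \<le> 2 * sin u * cos u"
    using sc \<open>0 \<le> cos u\<close> by (intro mult_right_mono) auto
  also have "\<dots> = sin x" by (simp add: u_def sin_double[symmetric])
  finally show ?thesis .
qed

text \<open>
  The base of the powers in the norm: the frequency, with the frequency \<open>0\<close> replaced by the
  smallest nonzero one. Being defined on all integers and periodic, it can be compared across
  congruent indices.
\<close>

definition weight :: "nat \<Rightarrow> int \<Rightarrow> real" where
  "weight K j = max (omega K j) (omega_min K)"

locale grid =
  fixes K :: nat
  assumes K_pos: "1 \<le> K"
begin

abbreviation "w \<equiv> weight K"
abbreviation "I \<equiv> modes K"
abbreviation "N \<equiv> norm_new K"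

lemma finite_modes [simp, intro]: "finite I"
  by (simp add: modes_def)

lemma omega_nonneg [simp]: "0 \<le> omega K j"
  using K_pos by (simp add: omega_def mesh_def)

lemma omega_0 [simp]: "omega K 0 = 0"
  by (simp add: omega_def)

lemma omega_formula: "omega K j = 2 * real K / pi * \<bar>sin (of_int j * pi / (2 * real K))\<bar>"
  using K_pos by (simp add: omega_def mesh_def field_simps)

lemma omega_le_abs: "omega K j \<le> \<bar>of_int j\<bar>"
proof -
  have "\<bar>sin (of_int j * pi / (2 * real K))\<bar> \<le> \<bar>of_int j * pi / (2 * real K)\<bar>"
    by (rule abs_sin_x_le_abs_x)
  also have "\<dots> = pi / (2 * real K) * \<bar>of_int j\<bar>" by (simp add: abs_mult)
  finally show ?thesis
    using K_pos by (simp add: omega_formula field_simps)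
qed

lemma half_abs_le_omega:
  assumes "j \<in> I"
  shows "\<bar>of_int j\<bar> / 2 \<le> omega K j"
proof -
  have jK: "\<bar>real_of_int j\<bar> \<le> real K" using assms by (auto simp: modes_def)
  define x where "x = \<bar>of_int j\<bar> * pi / (2 * real K)"
  have "0 \<le> x" by (simp add: x_def)
  moreover have "x \<le> pi / 2"
    using jK K_pos by (simp add: x_def field_simps)
  ultimately have "x / 2 \<le> sin x" by (rule half_le_sin)
  also have "sin x \<le> \<bar>sin (of_int j * pi / (2 * real K))\<bar>"
    by (cases "0 \<le> j") (auto simp: x_def)
  finally show ?thesis
    using K_pos by (simp add: omega_formula x_def field_simps)
qed

lemma omega_eq_0_iff:
  assumes "j \<in> I"
  shows "omega K j = 0 \<longleftrightarrow> j = 0"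
  using half_abs_le_omega[OF assms] by (auto simp: abs_if split: if_splits)

text \<open>
  Replacing \<open>k + l\<close> by \<open>j\<close> shifts the argument of the sine by a multiple of \<open>pi\<close>, which does not
  change its absolute value; hence aliasing modulo \<open>2 * K\<close> does no harm.
\<close>

lemma omega_subadditive:
  assumes "[k + l = j] (mod (2 * int K))"
  shows "omega K j \<le> omega K k + omega K l"
proof -
  obtain q where q: "j = k + l + 2 * int K * q"
    using assms by (metis cong_iff_lin)
  let ?x = "\<lambda>i. of_int i * pi / (2 * real K)"
  have "?x j = ?x k + ?x l + of_int q * pi"
    using K_pos by (simp add: q field_simps)
  then have "\<bar>sin (?x j)\<bar> = \<bar>sin (?x k + ?x l)\<bar> * \<bar>cos (of_int q * pi)\<bar>"
    using sin_zero_iff_int2[of "of_int q * pi"] by (auto simp: sin_add[of "?x k + ?x l"] abs_mult)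
  also have "\<dots> \<le> \<bar>sin (?x k + ?x l)\<bar> * 1"
    by (intro mult_left_mono) auto
  also have "\<dots> \<le> \<bar>sin (?x k) * cos (?x l)\<bar> + \<bar>cos (?x k) * sin (?x l)\<bar>"
    by (simp add: sin_add)
  also have "\<dots> \<le> \<bar>sin (?x k)\<bar> * 1 + 1 * \<bar>sin (?x l)\<bar>"
    unfolding abs_mult by (intro add_mono mult_mono) auto
  finally have "2 * real K / pi * \<bar>sin (?x j)\<bar> \<le> 2 * real K / pi * (\<bar>sin (?x k)\<bar> + \<bar>sin (?x l)\<bar>)"
    by (intro mult_left_mono) auto
  then show ?thesis by (simp only: omega_formula distrib_left)
qed

lemma omega_min_bounds: "1 / 2 \<le> omega_min K" "omega_min K \<le> 1"
  and omega_min_le: "j \<in> I \<Longrightarrow> j \<noteq> 0 \<Longrightarrow> omega_min K \<le> omega K j"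
proof -
  let ?A = "{omega K j | j. j \<in> I \<and> omega K j \<noteq> 0}"
  have A: "?A = omega K ` (I - {0})" using omega_eq_0_iff by auto
  have fin: "finite ?A" unfolding A by auto
  have m: "-1 \<in> I" using K_pos by (simp add: modes_def)
  then have ne: "?A \<noteq> {}" unfolding A by auto
  show le: "omega_min K \<le> omega K j" if "j \<in> I" "j \<noteq> 0" for j
    unfolding omega_min_def by (rule Min_le[OF fin]) (use A that in auto)
  show "omega_min K \<le> 1" using le[OF m] omega_le_abs[of "-1"] by simp
  show "1 / 2 \<le> omega_min K"
    unfolding omega_min_def
  proof (rule Min.boundedI[OF fin ne])
    fix a assume "a \<in> ?A"
    then obtain j where "j \<in> I" "j \<noteq> 0" "a = omega K j" unfolding A by auto
    moreover have "1 \<le> \<bar>real_of_int j\<bar>" using \<open>j \<noteq> 0\<close> by linarith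
    ultimately show "1 / 2 \<le> a" using half_abs_le_omega[of j] by simp
  qed
qed

lemma weight_0: "w 0 = omega_min K"
  using omega_min_bounds by (simp add: weight_def)

lemma weight_nonzero: "j \<in> I \<Longrightarrow> j \<noteq> 0 \<Longrightarrow> w j = omega K j"
  using omega_min_le[of j] by (simp add: weight_def)

lemma weight_ge_half: "1 / 2 \<le> w j"
  using omega_min_bounds by (simp add: weight_def)

lemma weight_pos [simp]: "0 < w j"
  using weight_ge_half[of j] by linarith

lemma weight_nonneg [simp]: "0 \<le> w j" and weight_neq_0 [simp]: "w j \<noteq> 0"
  using weight_pos[of j] by (auto simp del: weight_pos)

lemma omega_le_weight: "omega K j \<le> w j"
  by (simp add: weight_def)

lemma weight_subadditive:
  assumes "[k + l = j] (mod (2 * int K))"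
  shows "w j \<le> w k + w l"
  using omega_subadditive[OF assms] omega_nonneg[of k] omega_nonneg[of l] omega_min_bounds
  unfolding weight_def by linarith

lemma sum_inverse_squares_le: "(\<Sum>j=1..n. 1 / (real j)\<^sup>2) \<le> 2"
proof -
  have *: "(\<Sum>j=1..Suc n. 1 / (real j)\<^sup>2) \<le> 2 - 1 / real (Suc n)" for n
  proof (induction n)
    case (Suc n)
    have "1 / (real (Suc (Suc n)))\<^sup>2 \<le> 1 / real (Suc n) - 1 / real (Suc (Suc n))"
      using divide_left_mono[of "real (Suc n) * real (Suc (Suc n))" "(real (Suc (Suc n)))\<^sup>2" 1]
      by (simp add: diff_frac_eq power2_eq_square)
    with Suc show ?case by (simp add: algebra_simps)
  qed simp
  show ?thesis
  proof (cases n)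
    case (Suc m)
    have "0 \<le> 1 / real (Suc m)" by simp
    with *[of m] show ?thesis unfolding Suc by linarith
  qed simp
qed

text \<open>
  This is the discrete counterpart of the embedding of \<open>H\<^sup>1\<close> into the absolutely convergent Fourier
  series; that the bound does not depend on \<open>K\<close> is what makes all constants below uniform.
\<close>

lemma sum_inverse_weight_squares_le: "(\<Sum>j\<in>I. 1 / (w j)\<^sup>2) \<le> 20"
proof -
  let ?g = "\<lambda>j::int. 4 / (of_int j)\<^sup>2 :: real"
  have bd: "1 / (w j)\<^sup>2 \<le> ?g j" if "j \<in> I" "j \<noteq> 0" for j
  proof -
    have "(\<bar>of_int j\<bar> / 2)\<^sup>2 \<le> (w j)\<^sup>2"
      using half_abs_le_omega[OF that(1)] omega_le_weight[of j] by (intro power_mono) auto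
    then have "1 / (w j)\<^sup>2 \<le> 1 / (\<bar>of_int j\<bar> / 2)\<^sup>2"
      using that by (intro divide_left_mono mult_pos_pos zero_less_power) auto
    then show ?thesis by (simp add: power_divide)
  qed
  have b0: "1 / (w 0)\<^sup>2 \<le> 4"
  proof -
    have "(1 / 2)\<^sup>2 \<le> (w 0)\<^sup>2" using weight_ge_half by (intro power_mono) auto
    then have "1 / (w 0)\<^sup>2 \<le> 1 / (1 / 2)\<^sup>2"
      by (intro divide_left_mono mult_pos_pos zero_less_power) auto
    then show ?thesis by (simp add: power_divide)
  qed
  have pos: "(\<Sum>j\<in>{1..int K}. ?g j) \<le> 8"
  proof -
    have "(\<Sum>j\<in>{1..int K}. ?g j) = (\<Sum>j=1..K. 4 / (real j)\<^sup>2)"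
      by (rule sum.reindex_bij_witness[of _ int nat]) auto
    also have "\<dots> = 4 * (\<Sum>j=1..K. 1 / (real j)\<^sup>2)" by (simp add: sum_distrib_left)
    finally show ?thesis using sum_inverse_squares_le[of K] by simp
  qed
  have neg: "(\<Sum>j\<in>{-int K..-1}. ?g j) = (\<Sum>j\<in>{1..int K}. ?g j)"
    by (rule sum.reindex_bij_witness[of _ uminus uminus]) auto
  have split: "{-int K..int K} = insert 0 ({-int K..-1} \<union> {1..int K})" by auto
  have "(\<Sum>j\<in>I. 1 / (w j)\<^sup>2) \<le> (\<Sum>j\<in>I. if j = 0 then 4 else ?g j)"
    by (rule sum_mono) (use bd b0 in auto)
  also have "\<dots> \<le> (\<Sum>j\<in>{-int K..int K}. if j = 0 then 4 else ?g j)"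
    by (rule sum_mono2) (auto simp: modes_def)
  also have "\<dots> = 4 + ((\<Sum>j\<in>{-int K..-1}. ?g j) + (\<Sum>j\<in>{1..int K}. ?g j))"
    unfolding split
    by (subst sum.insert, simp, simp, subst sum.union_disjoint) (auto intro!: arg_cong2[of _ _ _ _ "(+)"] sum.cong)
  finally show ?thesis using pos neg by linarith
qed

end

section \<open>Residues and the discrete convolution\<close>

text \<open>
  The representative in the set of modes of a class modulo twice \<open>K\<close>. It turns the convolution,
  which is a sum over congruent pairs, into a sum over one index.
\<close>

definition residue :: "nat \<Rightarrow> int \<Rightarrow> int" where
  "residue K x = (x + int K) mod (2 * int K) - int K"

context grid
begin

lemma residue_in: "residue K x \<in> I"
proof -
  have "0 \<le> (x + int K) mod (2 * int K)" "(x + int K) mod (2 * int K) < 2 * int K"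
    using K_pos by auto
  then show ?thesis by (simp add: residue_def modes_def)
qed

lemma residue_cong: "[residue K x = x] (mod (2 * int K))"
proof -
  have "[(x + int K) mod (2 * int K) - int K = (x + int K) - int K] (mod (2 * int K))"
    by (rule cong_diff) auto
  then show ?thesis by (simp add: residue_def)
qed

lemma residue_unique:
  assumes "l \<in> I" "[l = x] (mod (2 * int K))"
  shows "residue K x = l"
proof -
  have "(x + int K) mod (2 * int K) = (l + int K) mod (2 * int K)"
    using cong_add[OF assms(2) cong_refl[of "int K"]] by (simp add: cong_def)
  also have "\<dots> = l + int K" using assms(1) by (intro mod_pos_pos_trivial) (auto simp: modes_def)
  finally show ?thesis by (simp add: residue_def)
qed

lemma add_cong_iff_residue:
  assumes "l \<in> I"
  shows "[k + l = j] (mod (2 * int K)) \<longleftrightarrow> l = residue K (j - k)"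
proof
  assume "[k + l = j] (mod (2 * int K))"
  from cong_diff[OF this cong_refl[of k]] have "[l = j - k] (mod (2 * int K))" by simp
  from residue_unique[OF assms this] show "l = residue K (j - k)" by simp
next
  assume "l = residue K (j - k)"
  then have "[l = j - k] (mod (2 * int K))" using residue_cong by simp
  from cong_add[OF cong_refl[of k] this] show "[k + l = j] (mod (2 * int K))" by simp
qed

lemma residue_diff_residue_diff:
  assumes "j \<in> I"
  shows "residue K (k + residue K (j - k)) = j" "residue K (k - residue K (k - j)) = j"
proof -
  have "[k + residue K (j - k) = k + (j - k)] (mod (2 * int K))"
    by (intro cong_add cong_refl residue_cong)
  then show "residue K (k + residue K (j - k)) = j"
    by (intro residue_unique assms) (simp add: cong_sym)
  have "[k - residue K (k - j) = k - (k - j)] (mod (2 * int K))"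
    by (intro cong_diff cong_refl residue_cong)
  then show "residue K (k - residue K (k - j)) = j"
    by (intro residue_unique assms) (simp add: cong_sym)
qed

lemma bij_residue_shift: "bij_betw (\<lambda>j. residue K (j - k)) I I"
proof (rule bij_betwI[where g = "\<lambda>l. residue K (k + l)"])
  fix l assume "l \<in> I"
  have "[residue K (k + l) - k = k + l - k] (mod (2 * int K))"
    by (intro cong_diff cong_refl residue_cong)
  then show "residue K (residue K (k + l) - k) = l"
    by (intro residue_unique \<open>l \<in> I\<close>) (simp add: cong_sym)
qed (auto simp: residue_in residue_diff_residue_diff)

lemma bij_residue_reflect: "bij_betw (\<lambda>k. residue K (j - k)) I I"
  by (rule bij_betwI[where g = "\<lambda>l. residue K (j - l)"])
     (auto simp: residue_in residue_diff_residue_diff)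

lemma dconv_eq: "dconv K y z j = (\<Sum>k\<in>I. y k * z (residue K (j - k)))"
proof -
  have "{(k, l). k \<in> I \<and> l \<in> I \<and> [k + l = j] (mod (2 * int K))}
      = (\<lambda>k. (k, residue K (j - k))) ` I"
    using add_cong_iff_residue residue_in by auto
  moreover have "inj_on (\<lambda>k. (k, residue K (j - k))) I" by (auto intro: inj_onI)
  ultimately show ?thesis unfolding dconv_def by (simp add: sum.reindex)
qed

lemma dconv_commute: "dconv K y z = dconv K z y"
proof
  fix j
  have "dconv K y z j = (\<Sum>k\<in>I. z (residue K (j - k)) * y (residue K (j - residue K (j - k))))"
    unfolding dconv_eq by (rule sum.cong) (auto simp: residue_diff_residue_diff mult.commute)
  also have "\<dots> = dconv K z y j"
    unfolding dconv_eq by (rule sum.reindex_bij_betw[OF bij_residue_reflect])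
  finally show "dconv K y z j = dconv K z y j" .
qed

end

section \<open>The weighted norms\<close>

context grid
begin

lemma norm_new_eq_L2_set: "N \<sigma> y = L2_set (\<lambda>j. w j powr \<sigma> * cmod (y j)) I"
proof -
  have "w j powr (2 * \<sigma>) = (w j powr \<sigma>)\<^sup>2" for j
    by (simp add: power2_eq_square powr_add[symmetric])
  then show ?thesis
    unfolding norm_new_def L2_set_def weight_def[symmetric] by (simp add: power_mult_distrib)
qed

lemma norm_new_nonneg [simp]: "0 \<le> N \<sigma> y"
  by (simp add: norm_new_eq_L2_set)

lemma norm_new_le:
  assumes "\<And>j. j \<in> I \<Longrightarrow> w j powr a * cmod (x j) \<le> B * (w j powr b * cmod (y j))" "0 \<le> B"
  shows "N a x \<le> B * N b y"
  unfolding norm_new_eq_L2_set L2_set_right_distrib[OF assms(2)]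
  by (rule L2_set_mono) (use assms in auto)

lemma norm_new_triangle: "N \<sigma> (\<lambda>j. y j + z j) \<le> N \<sigma> y + N \<sigma> z"
proof -
  have "N \<sigma> (\<lambda>j. y j + z j) \<le> L2_set (\<lambda>j. w j powr \<sigma> * cmod (y j) + w j powr \<sigma> * cmod (z j)) I"
    unfolding norm_new_eq_L2_set
    by (rule L2_set_mono) (auto simp: distrib_left[symmetric] norm_triangle_ineq mult_left_mono)
  also have "\<dots> \<le> N \<sigma> y + N \<sigma> z"
    unfolding norm_new_eq_L2_set by (rule L2_set_triangle_ineq)
  finally show ?thesis .
qed

lemma norm_new_scale: "N \<sigma> (\<lambda>j. of_real c * y j) = \<bar>c\<bar> * N \<sigma> y"
  unfolding norm_new_eq_L2_set L2_set_right_distrib[OF abs_ge_zero]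
  by (rule L2_set_cong) (auto simp: norm_mult)

lemma norm_new_minus: "N \<sigma> (\<lambda>j. - y j) = N \<sigma> y"
  using norm_new_scale[of \<sigma> "-1" y] by simp

lemma norm_new_diff_triangle: "N \<sigma> (\<lambda>j. y j - z j) \<le> N \<sigma> y + N \<sigma> z"
  using norm_new_triangle[of \<sigma> y "\<lambda>j. - z j"] by (simp add: norm_new_minus)

lemma norm_new_diff_commute: "N \<sigma> (\<lambda>j. y j - z j) = N \<sigma> (\<lambda>j. z j - y j)"
  using norm_new_minus[of \<sigma> "\<lambda>j. y j - z j"] by simp

lemma norm_new_lower_order:
  assumes "a \<le> b"
  shows "N a y \<le> 2 powr (b - a) * N b y"
proof (rule norm_new_le)
  fix j
  have "(1 / 2) powr (b - a) \<le> w j powr (b - a)"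
    using assms weight_ge_half[of j] by (intro powr_mono2) auto
  then have "w j powr a * 1 \<le> w j powr a * (2 powr (b - a) * w j powr (b - a))"
    by (intro mult_left_mono) (auto simp: powr_divide field_simps)
  also have "\<dots> = 2 powr (b - a) * w j powr b"
    by (simp add: powr_add[symmetric])
  finally have "w j powr a \<le> 2 powr (b - a) * w j powr b" by simp
  from mult_right_mono[OF this norm_ge_zero[of "y j"]]
  show "w j powr a * cmod (y j) \<le> 2 powr (b - a) * (w j powr b * cmod (y j))"
    by (simp add: mult.assoc)
qed auto

text \<open>
  A Fourier multiplier of size \<open>(h * w j) powr \<theta>\<close> trades \<open>\<theta>\<close> orders of regularity for a factor
  \<open>h powr \<theta>\<close>. With this lemma every bound on a trigonometric or coefficient function, the
  hypotheses on the coefficients included, becomes a norm bound.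
\<close>

lemma norm_new_multiplier:
  assumes "\<And>j. j \<in> I \<Longrightarrow> \<bar>m j\<bar> \<le> B * (h * w j) powr \<theta>" "0 \<le> B" "0 < h"
  shows "N (\<sigma> - \<theta>) (\<lambda>j. of_real (m j) * y j) \<le> B * h powr \<theta> * N \<sigma> y"
proof (rule norm_new_le)
  fix j assume j: "j \<in> I"
  have "w j powr (\<sigma> - \<theta>) * cmod (of_real (m j) * y j)
      \<le> w j powr (\<sigma> - \<theta>) * (B * (h * w j) powr \<theta> * cmod (y j))"
    using assms(1)[OF j] by (intro mult_left_mono) (auto simp: norm_mult mult_right_mono)
  also have "\<dots> = B * h powr \<theta> * (w j powr (\<sigma> - \<theta>) * w j powr \<theta> * cmod (y j))"
    using assms(3) by (simp add: powr_mult less_imp_le)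
  also have "w j powr (\<sigma> - \<theta>) * w j powr \<theta> = w j powr \<sigma>"
    by (simp add: powr_add[symmetric])
  finally show "w j powr (\<sigma> - \<theta>) * cmod (of_real (m j) * y j)
      \<le> B * h powr \<theta> * (w j powr \<sigma> * cmod (y j))" .
qed (use assms in auto)

lemma norm_new_bounded_multiplier:
  assumes "\<And>j. j \<in> I \<Longrightarrow> \<bar>m j\<bar> \<le> B" "0 \<le> B"
  shows "N \<sigma> (\<lambda>j. of_real (m j) * y j) \<le> B * N \<sigma> y"
  using norm_new_multiplier[of m B 1 0 \<sigma> y] assms by simp

text \<open>
  If a vector is bounded at one order and of size \<open>h powr k\<close> at \<open>k\<close> orders less, then it is of size
  \<open>h powr \<theta>\<close> in between. This follows frequency by frequency from \<open>x powr (- \<theta>) \<le> 1 + x powr (- k)\<close>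
  for \<open>x = h * w j\<close>. It yields all values of \<open>\<alpha>\<close> from the extreme ones.
\<close>

lemma norm_new_interpolate:
  assumes "0 < h" "0 \<le> \<theta>" "\<theta> \<le> k"
  shows "N (\<sigma> - \<theta>) y \<le> h powr \<theta> * (N \<sigma> y + N (\<sigma> - k) y / h powr k)"
proof -
  have pt: "w j powr (\<sigma> - \<theta>) \<le> h powr \<theta> * (w j powr \<sigma> + w j powr (\<sigma> - k) / h powr k)" for j
  proof -
    define x where "x = h * w j"
    have x: "0 < x" using assms by (simp add: x_def)
    have "x powr (- \<theta>) \<le> 1 + x powr (- k)"
    proof (cases "1 \<le> x")
      case True
      then have "x powr (- \<theta>) \<le> x powr 0" using assms by (intro powr_mono) auto
      then show ?thesis using x by (simp add: add_increasing2)
    next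
      case False
      then have "x powr (- \<theta>) \<le> x powr (- k)" using assms x by (intro powr_mono') auto
      then show ?thesis by simp
    qed
    then have "h powr \<theta> * w j powr \<sigma> * x powr (- \<theta>) \<le> h powr \<theta> * w j powr \<sigma> * (1 + x powr (- k))"
      by (intro mult_left_mono) auto
    moreover have "h powr \<theta> * w j powr \<sigma> * x powr (- \<theta>) = w j powr (\<sigma> - \<theta>)"
      using assms by (simp add: x_def powr_mult powr_diff powr_minus field_simps)
    moreover have "w j powr \<sigma> * x powr (- k) = w j powr (\<sigma> - k) / h powr k"
      using assms by (simp add: x_def powr_mult powr_diff powr_minus field_simps)
    moreover have "h powr \<theta> * w j powr \<sigma> * (1 + x powr (- k))
        = h powr \<theta> * (w j powr \<sigma> + w j powr \<sigma> * x powr (- k))"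
      by (simp add: algebra_simps)
    ultimately show ?thesis by simp
  qed
  have "N (\<sigma> - \<theta>) y \<le> L2_set (\<lambda>j. h powr \<theta> * (w j powr \<sigma> * cmod (y j) + 1 / h powr k * (w j powr (\<sigma> - k) * cmod (y j)))) I"
    unfolding norm_new_eq_L2_set
  proof (rule L2_set_mono)
    fix j
    show "w j powr (\<sigma> - \<theta>) * cmod (y j) \<le> h powr \<theta> * (w j powr \<sigma> * cmod (y j) + 1 / h powr k * (w j powr (\<sigma> - k) * cmod (y j)))"
      using mult_right_mono[OF pt[of j] norm_ge_zero[of "y j"]] by (simp add: algebra_simps)
  qed auto
  also have "\<dots> = h powr \<theta> * L2_set (\<lambda>j. w j powr \<sigma> * cmod (y j) + 1 / h powr k * (w j powr (\<sigma> - k) * cmod (y j))) I"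
    by (simp add: L2_set_right_distrib)
  also have "\<dots> \<le> h powr \<theta> * (N \<sigma> y + 1 / h powr k * N (\<sigma> - k) y)"
    by (intro mult_left_mono order_trans[OF L2_set_triangle_ineq])
       (auto simp: norm_new_eq_L2_set L2_set_right_distrib simp del: times_divide_eq_left)
  finally show ?thesis by simp
qed

end

section \<open>Products in the weighted norms\<close>

context grid
begin

lemma L2_set_inverse_weight: "L2_set (\<lambda>j. 1 / w j) I \<le> 5"
proof -
  have "L2_set (\<lambda>j. 1 / w j) I \<le> sqrt 20"
    unfolding L2_set_def using sum_inverse_weight_squares_le by (simp add: power_divide)
  also have "\<dots> \<le> 5" by (rule real_le_lsqrt) auto
  finally show ?thesis .
qed

lemma sum_div_weight_le: "(\<Sum>k\<in>I. \<bar>f k\<bar> / w k) \<le> 5 * L2_set f I"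
proof -
  have "(\<Sum>k\<in>I. \<bar>f k\<bar> / w k) \<le> L2_set f I * L2_set (\<lambda>k. 1 / w k) I"
    using L2_set_mult_ineq[of f "\<lambda>k. 1 / w k" I] by (simp add: less_imp_le)
  also have "\<dots> \<le> L2_set f I * 5"
    by (intro mult_left_mono L2_set_inverse_weight) auto
  finally show ?thesis by simp
qed

lemma L2_set_sum_le: "finite A \<Longrightarrow> L2_set (\<lambda>j. \<Sum>k\<in>A. f k j) B \<le> (\<Sum>k\<in>A. L2_set (f k) B)"
proof (induction A rule: finite_induct)
  case empty
  then show ?case by (simp add: L2_set_def)
next
  case (insert a A)
  then show ?case
    using L2_set_triangle_ineq[of "f a" "\<lambda>j. \<Sum>k\<in>A. f k j" B] by simp
qed

lemma L2_set_reindex: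
  assumes "bij_betw g A B"
  shows "L2_set (\<lambda>j. f (g j)) A = L2_set f B"
  unfolding L2_set_def using sum.reindex_bij_betw[OF assms, of "\<lambda>x. (f x)\<^sup>2"] by simp

text \<open>
  Young's inequality for the product of a summable and a square summable sequence.
\<close>

lemma L2_set_convolution_le:
  assumes "\<And>k. 0 \<le> f k"
  shows "L2_set (\<lambda>j. \<Sum>k\<in>I. f k * g (residue K (j - k))) I \<le> (\<Sum>k\<in>I. f k) * L2_set g I"
proof -
  have "L2_set (\<lambda>j. \<Sum>k\<in>I. f k * g (residue K (j - k))) I
      \<le> (\<Sum>k\<in>I. L2_set (\<lambda>j. f k * g (residue K (j - k))) I)"
    by (rule L2_set_sum_le) auto
  also have "\<dots> = (\<Sum>k\<in>I. f k * L2_set g I)"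
    using assms by (simp add: L2_set_right_distrib[symmetric] L2_set_reindex[OF bij_residue_shift])
  finally show ?thesis by (simp add: sum_distrib_right)
qed

text \<open>
  A product estimate for arbitrary orders \<open>a\<close>, \<open>b\<close>, \<open>c\<close> under a pointwise condition on the weights.
  Each of the three summands \<open>1 / w k\<close>, \<open>1 / w l\<close> and \<open>1 / w j\<close> supplies a square summable
  factor: in the first two cases it makes one of the two convolved sequences summable, so that
  Young's inequality applies, and in the third it multiplies the convolution, which is bounded by
  the Cauchy-Schwarz inequality.
\<close>

lemma norm_new_dconv_le:
  assumes weights: "\<And>j k l. j \<in> I \<Longrightarrow> k \<in> I \<Longrightarrow> l \<in> I \<Longrightarrow> [k + l = j] (mod (2 * int K)) \<Longrightarrow>
      w j powr c \<le> D * (w k powr a * w l powr b * (1 / w j + 1 / w k + 1 / w l))"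
    and D: "0 \<le> D"
  shows "N c (dconv K y z) \<le> 15 * D * N a y * N b z"
proof -
  define A where "A k = w k powr a * cmod (y k)" for k
  define B where "B l = w l powr b * cmod (z l)" for l
  let ?r = "\<lambda>j k. residue K (j - k)"
  have A0: "0 \<le> A k" and B0: "0 \<le> B k" for k by (auto simp: A_def B_def)
  define T1 where "T1 j = 1 / w j * (\<Sum>k\<in>I. A k * B (?r j k))" for j
  define T2 where "T2 j = (\<Sum>k\<in>I. A k / w k * B (?r j k))" for j
  define T3 where "T3 j = (\<Sum>k\<in>I. B k / w k * A (?r j k))" for j
  \<comment> \<open>Reflecting the summation index puts the third sum into the form required by Young's inequality.\<close>
  have T3: "T3 j = (\<Sum>k\<in>I. A k * (B (?r j k) / w (?r j k)))" if "j \<in> I" for j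
  proof -
    have "T3 j = (\<Sum>k\<in>I. B (?r j k) / w (?r j k) * A (?r j (?r j k)))"
      unfolding T3_def by (rule sum.reindex_bij_betw[OF bij_residue_reflect, symmetric])
    also have "\<dots> = (\<Sum>k\<in>I. A k * (B (?r j k) / w (?r j k)))"
      by (rule sum.cong) (auto simp: residue_diff_residue_diff)
    finally show ?thesis .
  qed
  have pt: "w j powr c * cmod (dconv K y z j) \<le> D * (T1 j + T2 j + T3 j)" if j: "j \<in> I" for j
  proof -
    have "w j powr c * cmod (dconv K y z j) \<le> w j powr c * (\<Sum>k\<in>I. cmod (y k) * cmod (z (?r j k)))"
      unfolding dconv_eq by (intro mult_left_mono order_trans[OF norm_sum]) (auto simp: norm_mult)
    also have "\<dots> = (\<Sum>k\<in>I. w j powr c * (cmod (y k) * cmod (z (?r j k))))"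
      by (simp add: sum_distrib_left)
    also have "\<dots> \<le> (\<Sum>k\<in>I. D * (A k * B (?r j k) * (1 / w j + 1 / w k + 1 / w (?r j k))))"
    proof (rule sum_mono)
      fix k assume k: "k \<in> I"
      have "w j powr c \<le> D * (w k powr a * w (?r j k) powr b * (1 / w j + 1 / w k + 1 / w (?r j k)))"
        using j k by (intro weights) (auto simp: residue_in add_cong_iff_residue)
      then have "w j powr c * (cmod (y k) * cmod (z (?r j k)))
          \<le> D * (w k powr a * w (?r j k) powr b * (1 / w j + 1 / w k + 1 / w (?r j k)))
            * (cmod (y k) * cmod (z (?r j k)))"
        by (intro mult_right_mono) auto
      also have "\<dots> = D * (A k * B (?r j k) * (1 / w j + 1 / w k + 1 / w (?r j k)))"
        by (simp add: A_def B_def mult_ac)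
      finally show "w j powr c * (cmod (y k) * cmod (z (?r j k)))
          \<le> D * (A k * B (?r j k) * (1 / w j + 1 / w k + 1 / w (?r j k)))" .
    qed
    also have "\<dots> = D * (\<Sum>k\<in>I. 1 / w j * (A k * B (?r j k)) + A k / w k * B (?r j k)
        + A k * (B (?r j k) / w (?r j k)))"
      unfolding sum_distrib_left[symmetric] by (simp add: algebra_simps)
    also have "\<dots> = D * (T1 j + T2 j + T3 j)"
      by (simp add: T1_def T2_def T3[OF j] sum.distrib sum_distrib_left sum_divide_distrib)
    finally show ?thesis .
  qed
  have nA: "L2_set A I = N a y" and nB: "L2_set B I = N b z"
    by (auto simp: norm_new_eq_L2_set A_def[abs_def] B_def[abs_def])
  have "L2_set T1 I \<le> L2_set (\<lambda>j. (N a y * N b z) * (1 / w j)) I"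
  proof (rule L2_set_mono)
    fix j
    have "(\<Sum>k\<in>I. A k * B (?r j k)) \<le> L2_set A I * L2_set (\<lambda>k. B (?r j k)) I"
      using L2_set_mult_ineq[of A "\<lambda>k. B (?r j k)" I] A0 B0 by simp
    also have "L2_set (\<lambda>k. B (?r j k)) I = L2_set B I"
      by (rule L2_set_reindex[OF bij_residue_reflect])
    finally have "1 / w j * (\<Sum>k\<in>I. A k * B (?r j k)) \<le> 1 / w j * (N a y * N b z)"
      by (intro mult_left_mono) (auto simp: nA nB less_imp_le)
    then show "T1 j \<le> (N a y * N b z) * (1 / w j)" by (simp add: T1_def)
    show "0 \<le> T1 j" using A0 B0 by (auto simp: T1_def less_imp_le intro!: mult_nonneg_nonneg divide_nonneg_nonneg sum_nonneg)
  qed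
  also have "\<dots> = (N a y * N b z) * L2_set (\<lambda>j. 1 / w j) I"
    by (subst L2_set_right_distrib) auto
  also have "\<dots> \<le> (N a y * N b z) * 5"
    by (intro mult_left_mono L2_set_inverse_weight) auto
  finally have 1: "L2_set T1 I \<le> 5 * N a y * N b z" by simp
  have "L2_set T2 I \<le> (\<Sum>k\<in>I. A k / w k) * L2_set B I"
    unfolding T2_def by (rule L2_set_convolution_le) (auto simp: A0 less_imp_le)
  also have "\<dots> \<le> 5 * L2_set A I * L2_set B I"
    using sum_div_weight_le[of A] A0 by (intro mult_right_mono) auto
  finally have 2: "L2_set T2 I \<le> 5 * N a y * N b z" by (simp add: nA nB)
  have "L2_set T3 I \<le> (\<Sum>k\<in>I. B k / w k) * L2_set A I"
    unfolding T3_def by (rule L2_set_convolution_le) (auto simp: B0 less_imp_le)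
  also have "\<dots> \<le> 5 * L2_set B I * L2_set A I"
    using sum_div_weight_le[of B] B0 by (intro mult_right_mono) auto
  finally have 3: "L2_set T3 I \<le> 5 * N a y * N b z" by (simp add: nA nB mult_ac)
  have "N c (dconv K y z) \<le> L2_set (\<lambda>j. D * (T1 j + T2 j + T3 j)) I"
    unfolding norm_new_eq_L2_set by (rule L2_set_mono) (use pt in auto)
  also have "\<dots> = D * L2_set (\<lambda>j. T1 j + T2 j + T3 j) I"
    using D by (simp add: L2_set_right_distrib)
  also have "\<dots> \<le> D * (L2_set T1 I + L2_set T2 I + L2_set T3 I)"
    using L2_set_triangle_ineq[of "\<lambda>j. T1 j + T2 j" T3 I] L2_set_triangle_ineq[of T1 T2 I] D
    by (intro mult_left_mono) auto
  also have "\<dots> \<le> D * (5 * N a y * N b z + 5 * N a y * N b z + 5 * N a y * N b z)"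
    using 1 2 3 D by (intro mult_left_mono add_mono) auto
  finally show ?thesis by (simp add: algebra_simps)
qed

end

text \<open>
  The elementary inequality behind the product estimates: by the triangle inequality \<open>x\<close> is at
  most twice the larger one of \<open>y\<close> and \<open>z\<close>. If this is \<open>y\<close>, the power of \<open>x\<close> is absorbed by that
  of \<open>y\<close>; if it is \<open>z\<close>, then \<open>r - \<tau>\<close> orders can be moved from \<open>z\<close> to \<open>y\<close>.
\<close>

lemma powr_triangle_product:
  fixes x y z \<tau> r :: real
  assumes x: "1 / 2 \<le> x" and y: "1 / 2 \<le> y" and z: "1 / 2 \<le> z" and tri: "x \<le> y + z"
    and \<tau>: "0 \<le> \<tau>" "\<tau> \<le> r" and r: "1 \<le> r"
  shows "x powr \<tau> \<le> 4 powr r * (y powr \<tau> * z powr r * (1 / y + 1 / z))"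
proof -
  have pos: "0 < x" "0 < y" "0 < z" using x y z by auto
  have half: "1 \<le> 2 powr r * u powr (r - 1)" if "1 / 2 \<le> u" for u :: real
  proof -
    have "(1 / 2) powr (r - 1) \<le> u powr (r - 1)" using that r by (intro powr_mono2) auto
    moreover have "2 powr r * (1 / 2) powr (r - 1) = (2::real)"
      by (simp add: powr_divide powr_diff)
    ultimately show ?thesis
      using mult_left_mono[of "(1 / 2) powr (r - 1)" "u powr (r - 1)" "2 powr r"] by simp
  qed
  have two: "2 powr \<tau> * 2 powr r \<le> (4::real) powr r"
  proof -
    have "2 powr \<tau> * 2 powr r \<le> 2 powr r * (2::real) powr r"
      using \<tau> by (intro mult_right_mono powr_mono) auto
    also have "\<dots> = 4 powr r" using powr_mult[of 2 2 r] by simp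
    finally show ?thesis .
  qed
  show ?thesis
  proof (cases "z \<le> y")
    case True
    have "x powr \<tau> \<le> (2 * y) powr \<tau>" using True tri pos \<tau> by (intro powr_mono2) auto
    also have "\<dots> = 2 powr \<tau> * y powr \<tau> * 1" using pos by (simp add: powr_mult)
    also have "\<dots> \<le> 2 powr \<tau> * y powr \<tau> * (2 powr r * z powr (r - 1))"
      by (intro mult_left_mono half z) auto
    also have "\<dots> = 2 powr \<tau> * 2 powr r * (y powr \<tau> * z powr r * (1 / z))"
      using pos by (simp add: powr_diff)
    also have "\<dots> \<le> 4 powr r * (y powr \<tau> * z powr r * (1 / y + 1 / z))"
      using pos two by (intro mult_mono two) auto
    finally show ?thesis .
  next
    case False
    have "x powr \<tau> \<le> (2 * z) powr \<tau>" using False tri pos \<tau> by (intro powr_mono2) auto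
    also have "\<dots> = 2 powr \<tau> * z powr \<tau> * 1" using pos by (simp add: powr_mult)
    also have "\<dots> \<le> 2 powr \<tau> * z powr \<tau> * (2 powr r * y powr (r - 1))"
      by (intro mult_left_mono half y) auto
    also have "y powr (r - 1) = y powr (r - \<tau>) * (y powr \<tau> * (1 / y))"
      using pos by (simp add: powr_diff)
    also have "2 powr \<tau> * z powr \<tau> * (2 powr r * (y powr (r - \<tau>) * (y powr \<tau> * (1 / y))))
        \<le> 2 powr \<tau> * z powr \<tau> * (2 powr r * (z powr (r - \<tau>) * (y powr \<tau> * (1 / y))))"
      using False pos \<tau> by (intro mult_left_mono mult_right_mono powr_mono2) auto
    also have "\<dots> = 2 powr \<tau> * 2 powr r * (y powr \<tau> * z powr r * (1 / y))"
      using pos by (simp add: powr_diff)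
    also have "\<dots> \<le> 4 powr r * (y powr \<tau> * z powr r * (1 / y + 1 / z))"
      using pos two by (intro mult_mono two) auto
    finally show ?thesis .
  qed
qed

text \<open>
  The factor \<open>15\<close> collects three sums, each with a square summable factor of norm at most \<open>5\<close>; the
  power of \<open>4\<close> comes from distributing the weight of the result over the two factors.
\<close>

definition product_const :: "real \<Rightarrow> real" where
  "product_const s = 15 * 4 powr (s + 1)"

lemma product_const_ge_1: "0 \<le> s \<Longrightarrow> 1 \<le> product_const s"
  using powr_mono[of 0 "s + 1" "4::real"] by (simp add: product_const_def)

locale smooth_grid = grid +
  fixes s :: real
  assumes s_nonneg: "0 \<le> s"
begin

abbreviation "P \<equiv> product_const s"

lemma P_ge_1: "1 \<le> P" and P_nonneg [simp]: "0 \<le> P"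
  using product_const_ge_1[OF s_nonneg] by auto

text \<open>
  Multiplication by a function of order \<open>s + 1\<close> is bounded at each order of modulus at most
  \<open>s + 1\<close>. For negative orders the argument is that of duality: the weights of \<open>j\<close> and \<open>k\<close> exchange
  their roles in \<open>powr_triangle_product\<close>.
\<close>

lemma norm_new_dconv_smooth_right:
  assumes "\<bar>\<tau>\<bar> \<le> s + 1"
  shows "N \<tau> (dconv K y z) \<le> P * N \<tau> y * N (s + 1) z"
  unfolding product_const_def
proof (rule norm_new_dconv_le)
  fix j k l assume jkl: "j \<in> I" "k \<in> I" "l \<in> I" "[k + l = j] (mod (2 * int K))"
  have tri: "w j \<le> w k + w l" by (rule weight_subadditive[OF jkl(4)])
  show "w j powr \<tau> \<le> 4 powr (s + 1) * (w k powr \<tau> * w l powr (s + 1) * (1 / w j + 1 / w k + 1 / w l))"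
  proof (cases "0 \<le> \<tau>")
    case True
    have "w j powr \<tau> \<le> 4 powr (s + 1) * (w k powr \<tau> * w l powr (s + 1) * (1 / w k + 1 / w l))"
      using True assms s_nonneg tri by (intro powr_triangle_product weight_ge_half) auto
    also have "\<dots> \<le> 4 powr (s + 1) * (w k powr \<tau> * w l powr (s + 1) * (1 / w j + 1 / w k + 1 / w l))"
      by (intro mult_left_mono) (auto simp: less_imp_le)
    finally show ?thesis .
  next
    case False
    \<comment> \<open>The roles of \<open>j\<close> and \<open>k\<close> are exchanged; multiplying by both weights undoes the change of sign.\<close>
    have "[- l + j = k] (mod (2 * int K))"
      using cong_diff[OF cong_sym[OF jkl(4)] cong_refl[of l]] by (simp add: add.commute)
    from omega_subadditive[OF this] have "omega K k \<le> omega K l + omega K j"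
      by (simp add: omega_formula)
    then have tri': "w k \<le> w j + w l"
      using omega_nonneg[of j] omega_nonneg[of l] omega_min_bounds
      unfolding weight_def by linarith
    have "w k powr (- \<tau>) \<le> 4 powr (s + 1) * (w j powr (- \<tau>) * w l powr (s + 1) * (1 / w j + 1 / w l))"
      using False assms s_nonneg tri' by (intro powr_triangle_product weight_ge_half) auto
    also have "\<dots> \<le> 4 powr (s + 1) * (w j powr (- \<tau>) * w l powr (s + 1) * (1 / w j + 1 / w k + 1 / w l))"
      by (intro mult_left_mono) (auto simp: less_imp_le)
    finally have "(w j powr \<tau> * w k powr \<tau>) * w k powr (- \<tau>) \<le> (w j powr \<tau> * w k powr \<tau>) *
        (4 powr (s + 1) * (w j powr (- \<tau>) * w l powr (s + 1) * (1 / w j + 1 / w k + 1 / w l)))"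
      by (intro mult_left_mono) auto
    also have "\<dots> = (w j powr \<tau> * w j powr (- \<tau>)) *
        (4 powr (s + 1) * (w k powr \<tau> * w l powr (s + 1) * (1 / w j + 1 / w k + 1 / w l)))"
      by (simp only: mult_ac)
    finally show ?thesis by (simp add: powr_add[symmetric] mult.assoc)
  qed
qed auto

lemma norm_new_dconv_smooth_left:
  assumes "\<bar>\<tau>\<bar> \<le> s + 1"
  shows "N \<tau> (dconv K y z) \<le> P * N (s + 1) y * N \<tau> z"
  using norm_new_dconv_smooth_right[OF assms, of z y] by (simp add: dconv_commute[of y z] mult_ac)

text \<open>
  Needed for the product of two first differences, which are only bounded at order \<open>s\<close>. For \<open>s = 0\<close>
  it is the embedding of \<open>L\<^sup>1\<close> into \<open>H\<close> of order \<open>-1\<close>.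
\<close>

lemma norm_new_dconv_one_less:
  "N (s - 1) (dconv K y z) \<le> P * N s y * N s z"
  unfolding product_const_def
proof (rule norm_new_dconv_le)
  fix j k l assume jkl: "j \<in> I" "k \<in> I" "l \<in> I" "[k + l = j] (mod (2 * int K))"
  have "w j powr s \<le> (4 * w k * w l) powr s"
  proof (rule powr_mono2)
    have "w j \<le> w k * 1 + w l * 1" using weight_subadditive[OF jkl(4)] by simp
    also have "\<dots> \<le> w k * (2 * w l) + w l * (2 * w k)"
      using weight_ge_half[of l] weight_ge_half[of k] by (intro add_mono mult_left_mono) auto
    finally show "w j \<le> 4 * w k * w l" by simp
  qed (use s_nonneg in \<open>auto simp: less_imp_le\<close>)
  also have "\<dots> = 4 powr s * w k powr s * w l powr s"
    by (simp add: powr_mult less_imp_le)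
  also have "\<dots> \<le> 4 powr (s + 1) * w k powr s * w l powr s"
    by (intro mult_right_mono powr_mono) auto
  finally have "w j powr s * (1 / w j) \<le> 4 powr (s + 1) * w k powr s * w l powr s * (1 / w j)"
    by (rule mult_right_mono) (simp add: less_imp_le)
  also have "\<dots> \<le> 4 powr (s + 1) * w k powr s * w l powr s * (1 / w j + 1 / w k + 1 / w l)"
    by (intro mult_left_mono) (auto simp: less_imp_le)
  finally show "w j powr (s - 1) \<le> 4 powr (s + 1) * (w k powr s * w l powr s * (1 / w j + 1 / w k + 1 / w l))"
    by (simp add: powr_diff mult_ac)
qed auto

end

section \<open>A mean value inequality and powers of the convolution\<close>

definition conv_power :: "nat \<Rightarrow> nat \<Rightarrow> (int \<Rightarrow> complex) \<Rightarrow> int \<Rightarrow> complex" where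
  "conv_power K n y = (dconv K y ^^ n) y"

lemma conv_power_0: "conv_power K 0 y = y"
  and conv_power_Suc: "conv_power K (Suc n) y = dconv K y (conv_power K n y)"
  by (simp_all add: conv_power_def)

context grid
begin

lemma dconv_diff_left: "dconv K (\<lambda>k. y k - y' k) z j = dconv K y z j - dconv K y' z j"
  by (simp add: dconv_eq left_diff_distrib sum_subtractf)

lemma dconv_diff_right: "dconv K y (\<lambda>k. z k - z' k) j = dconv K y z j - dconv K y z' j"
  by (simp add: dconv_eq right_diff_distrib sum_subtractf)

lemma dconv_add_left: "dconv K (\<lambda>k. y k + y' k) z j = dconv K y z j + dconv K y' z j"
  by (simp add: dconv_eq distrib_right sum.distrib)

lemma dconv_add_right: "dconv K y (\<lambda>k. z k + z' k) j = dconv K y z j + dconv K y z' j"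
  by (simp add: dconv_eq distrib_left sum.distrib)

lemma dconv_scale_left: "dconv K (\<lambda>k. c * y k) z j = c * dconv K y z j"
  by (simp add: dconv_eq sum_distrib_left mult.assoc)

lemma dconv_scale_right: "dconv K y (\<lambda>k. c * z k) j = c * dconv K y z j"
  by (simp add: dconv_eq sum_distrib_left mult.left_commute)

lemmas dconv_linear = dconv_diff_left dconv_diff_right dconv_add_left dconv_add_right
  dconv_scale_left dconv_scale_right

text \<open>
  Pairing \<open>X\<close> with the fixed vector \<open>X b - X a\<close> in the inner product of order \<open>\<sigma>\<close> gives a real function,
  to which the mean value theorem and the Cauchy-Schwarz inequality apply. In this way integrals of
  vector valued functions are avoided: a variation of constants formula is used by differentiating
  the quantity that it describes.
\<close>

lemma norm_new_mean_value:
  assumes "a \<le> b"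
    and deriv: "\<And>\<tau> j. \<tau> \<in> {a..b} \<Longrightarrow> j \<in> I \<Longrightarrow>
      ((\<lambda>\<tau>. X \<tau> j) has_vector_derivative \<phi> \<tau> j) (at \<tau> within {a..b})"
    and bound: "\<And>\<tau>. \<tau> \<in> {a..b} \<Longrightarrow> N \<sigma> (\<phi> \<tau>) \<le> B"
  shows "N \<sigma> (\<lambda>j. X b j - X a j) \<le> B * (b - a)"
proof -
  define x where "x j = X b j - X a j" for j
  define q where "q \<tau> = (\<Sum>j\<in>I. w j powr (2 * \<sigma>) * (x j \<bullet> X \<tau> j))" for \<tau>
  define q' where "q' \<tau> = (\<Sum>j\<in>I. w j powr (2 * \<sigma>) * (x j \<bullet> \<phi> \<tau> j))" for \<tau>
  have sq: "w j powr (2 * \<sigma>) = w j powr \<sigma> * w j powr \<sigma>" for j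
    by (simp add: powr_add[symmetric])
  have "(q has_vector_derivative q' \<tau>) (at \<tau> within {a..b})" if "\<tau> \<in> {a..b}" for \<tau>
    unfolding q_def q'_def
    by (intro has_vector_derivative_sum has_vector_derivative_mult_right
        bounded_linear.has_vector_derivative[OF bounded_linear_inner_right] deriv that)
  then obtain \<tau> where \<tau>: "\<tau> \<in> {a..b}" "q b - q a = (b - a) * q' \<tau>"
    using mvt_very_simple[OF \<open>a \<le> b\<close>, of q "\<lambda>\<tau> t. t * q' \<tau>"]
    by (auto simp: has_vector_derivative_def)
  have "(N \<sigma> x)\<^sup>2 = (\<Sum>j\<in>I. w j powr (2 * \<sigma>) * (x j \<bullet> x j))"
    unfolding norm_new_eq_L2_set L2_set_def
    by (subst real_sqrt_pow2) (auto simp: sum_nonneg sq power2_norm_eq_inner power_mult_distrib power2_eq_square[of "w _ powr _"])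
  also have "\<dots> = q b - q a"
    by (simp add: q_def x_def inner_diff_right right_diff_distrib sum_subtractf)
  also have "\<dots> = (b - a) * q' \<tau>" by (fact \<tau>)
  also have "q' \<tau> \<le> (\<Sum>j\<in>I. \<bar>w j powr \<sigma> * cmod (x j)\<bar> * \<bar>w j powr \<sigma> * cmod (\<phi> \<tau> j)\<bar>)"
    unfolding q'_def
  proof (rule sum_mono)
    fix j
    have "w j powr (2 * \<sigma>) * (x j \<bullet> \<phi> \<tau> j) \<le> w j powr (2 * \<sigma>) * (cmod (x j) * cmod (\<phi> \<tau> j))"
      by (intro mult_left_mono norm_cauchy_schwarz) auto
    then show "w j powr (2 * \<sigma>) * (x j \<bullet> \<phi> \<tau> j) \<le> \<bar>w j powr \<sigma> * cmod (x j)\<bar> * \<bar>w j powr \<sigma> * cmod (\<phi> \<tau> j)\<bar>"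
      unfolding sq by (simp add: mult_ac)
  qed
  also have "\<dots> \<le> N \<sigma> x * N \<sigma> (\<phi> \<tau>)"
    unfolding norm_new_eq_L2_set by (rule L2_set_mult_ineq)
  also have "\<dots> \<le> N \<sigma> x * B"
    by (intro mult_left_mono bound \<tau>) auto
  finally have le: "(N \<sigma> x)\<^sup>2 \<le> (b - a) * (N \<sigma> x * B)"
    using \<open>a \<le> b\<close> by (simp add: mult_left_mono)
  have "0 \<le> B" using order_trans[OF norm_new_nonneg bound[of a]] \<open>a \<le> b\<close> by simp
  have "N \<sigma> x \<le> B * (b - a)"
  proof (cases "N \<sigma> x = 0")
    case True
    then show ?thesis using \<open>0 \<le> B\<close> \<open>a \<le> b\<close> by simp
  next
    case False
    then have "0 < N \<sigma> x" using norm_new_nonneg[of \<sigma> x] by linarith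
    moreover have "N \<sigma> x * N \<sigma> x \<le> N \<sigma> x * (B * (b - a))"
      using le by (simp add: power2_eq_square mult_ac)
    ultimately show ?thesis by (rule mult_left_le_imp_le[rotated])
  qed
  then show ?thesis by (simp add: x_def[abs_def])
qed

end

context smooth_grid
begin

lemma norm_new_conv_power:
  assumes "N (s + 1) y \<le> R" "1 \<le> R"
  shows "N (s + 1) (conv_power K n y) \<le> (P * R) ^ n * R"
proof (induction n)
  case 0
  then show ?case using assms by (simp add: conv_power_0)
next
  case (Suc n)
  have "N (s + 1) (conv_power K (Suc n) y) \<le> P * N (s + 1) y * N (s + 1) (conv_power K n y)"
    unfolding conv_power_Suc by (rule norm_new_dconv_smooth_right) (use s_nonneg in auto)
  also have "\<dots> \<le> P * R * ((P * R) ^ n * R)"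
    using assms Suc by (intro mult_mono) auto
  finally show ?case by (simp add: mult_ac)
qed

lemma norm_new_conv_power_diff:
  assumes "\<bar>\<tau>\<bar> \<le> s + 1" and y: "N (s + 1) y \<le> R" and z: "N (s + 1) z \<le> R" and R: "1 \<le> R"
  shows "N \<tau> (\<lambda>j. conv_power K n y j - conv_power K n z j)
    \<le> (real n + 1) * (P * R) ^ n * N \<tau> (\<lambda>j. y j - z j)"
proof (induction n)
  case 0
  then show ?case by (simp add: conv_power_0)
next
  case (Suc n)
  let ?d = "\<lambda>j. y j - z j" and ?F = "conv_power K n"
  let ?D = "\<lambda>j. ?F y j - ?F z j"
  have "N \<tau> (\<lambda>j. conv_power K (Suc n) y j - conv_power K (Suc n) z j)
      = N \<tau> (\<lambda>j. dconv K ?d (?F y) j + dconv K z ?D j)"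
    by (simp add: conv_power_Suc dconv_linear)
  also have "\<dots> \<le> N \<tau> (dconv K ?d (?F y)) + N \<tau> (dconv K z ?D)"
    by (rule norm_new_triangle)
  also have "\<dots> \<le> P * N \<tau> ?d * N (s + 1) (?F y) + P * N (s + 1) z * N \<tau> ?D"
    by (intro add_mono norm_new_dconv_smooth_left norm_new_dconv_smooth_right assms)
  also have "\<dots> \<le> P * N \<tau> ?d * ((P * R) ^ n * R) + P * R * ((real n + 1) * (P * R) ^ n * N \<tau> ?d)"
    using assms norm_new_conv_power[OF y R] Suc
    by (intro add_mono mult_mono mult_left_mono) auto
  also have "\<dots> = (real (Suc n) + 1) * (P * R) ^ Suc n * N \<tau> ?d"
    by (simp add: algebra_simps)
  finally show ?case .
qed

text \<open>
  The second difference of a power is controlled by the second difference of its argument and the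
  square of the first differences, with no reference to a derivative of the power. The right-hand
  side has this form because \<open>1 + (n + 1)\<^sup>2 + 2 * (n + 1) = (n + 2)\<^sup>2\<close>.
\<close>

lemma norm_new_conv_power_second_diff:
  assumes u: "N (s + 1) u \<le> R" and v: "N (s + 1) v \<le> R" and z: "N (s + 1) z \<le> R" and R: "1 \<le> R"
    and du: "N s (\<lambda>j. u j - z j) \<le> \<delta>" and dv: "N s (\<lambda>j. v j - z j) \<le> \<delta>"
    and dd: "N (s - 1) (\<lambda>j. u j + v j - 2 * z j) \<le> \<epsilon>"
  shows "N (s - 1) (\<lambda>j. conv_power K n u j + conv_power K n v j - 2 * conv_power K n z j)
    \<le> (real n + 1)\<^sup>2 * (P * R) ^ n * (\<epsilon> + \<delta>\<^sup>2)"
proof (induction n)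
  case 0
  then show ?case using dd by (simp add: conv_power_0 add_increasing2)
next
  case (Suc n)
  let ?F = "conv_power K n"
  let ?D = "\<lambda>j. u j + v j - 2 * z j" and ?E = "\<lambda>j. ?F u j + ?F v j - 2 * ?F z j"
  let ?a = "\<lambda>j. u j - z j" and ?b = "\<lambda>j. v j - z j"
  let ?A = "\<lambda>j. ?F u j - ?F z j" and ?B = "\<lambda>j. ?F v j - ?F z j"
  define Q where "Q = (P * R) ^ n"
  have Q: "0 \<le> Q" using R by (simp add: Q_def)
  have d0: "0 \<le> \<delta>" and e0: "0 \<le> \<epsilon>"
    using order_trans[OF norm_new_nonneg du] order_trans[OF norm_new_nonneg dd] by auto
  have lip: "N s ?A \<le> (real n + 1) * Q * \<delta>" "N s ?B \<le> (real n + 1) * Q * \<delta>"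
  proof -
    have "\<bar>s\<bar> \<le> s + 1" using s_nonneg by simp
    note L = norm_new_conv_power_diff[OF this _ z R, of _ n, folded Q_def]
    show "N s ?A \<le> (real n + 1) * Q * \<delta>"
      using Q by (intro order_trans[OF L[OF u]] mult_left_mono du) auto
    show "N s ?B \<le> (real n + 1) * Q * \<delta>"
      using Q by (intro order_trans[OF L[OF v]] mult_left_mono dv) auto
  qed
  have "N (s - 1) (\<lambda>j. conv_power K (Suc n) u j + conv_power K (Suc n) v j - 2 * conv_power K (Suc n) z j)
      = N (s - 1) (\<lambda>j. (dconv K ?D (?F z) j + dconv K z ?E j) + (dconv K ?a ?A j + dconv K ?b ?B j))"
    by (simp add: conv_power_Suc dconv_linear)
  also have "\<dots> \<le> (N (s - 1) (dconv K ?D (?F z)) + N (s - 1) (dconv K z ?E))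
      + (N (s - 1) (dconv K ?a ?A) + N (s - 1) (dconv K ?b ?B))"
    by (intro order_trans[OF norm_new_triangle] add_mono norm_new_triangle)
  also have "\<dots> \<le> (P * N (s - 1) ?D * N (s + 1) (?F z) + P * N (s + 1) z * N (s - 1) ?E)
      + (P * N s ?a * N s ?A + P * N s ?b * N s ?B)"
    using s_nonneg
    by (intro add_mono norm_new_dconv_smooth_left norm_new_dconv_smooth_right norm_new_dconv_one_less) auto
  also have "\<dots> \<le> (P * \<epsilon> * (Q * R) + P * R * ((real n + 1)\<^sup>2 * Q * (\<epsilon> + \<delta>\<^sup>2)))
      + (P * \<delta> * ((real n + 1) * Q * \<delta>) + P * \<delta> * ((real n + 1) * Q * \<delta>))"
    using assms norm_new_conv_power[OF z R, of n] Suc lip d0 e0 Q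
    by (intro add_mono mult_mono mult_left_mono) (auto simp: Q_def)
  also have "\<dots> = P * Q * (R * \<epsilon> + R * ((real n + 1)\<^sup>2 * (\<epsilon> + \<delta>\<^sup>2)) + 1 * (2 * (real n + 1) * \<delta>\<^sup>2))"
    by (simp add: algebra_simps power2_eq_square)
  also have "\<dots> \<le> P * Q * (R * (\<epsilon> + \<delta>\<^sup>2) + R * ((real n + 1)\<^sup>2 * (\<epsilon> + \<delta>\<^sup>2)) + R * (2 * (real n + 1) * (\<epsilon> + \<delta>\<^sup>2)))"
    using R Q d0 e0 by (intro mult_left_mono add_mono mult_mono) auto
  also have "\<dots> = (real (Suc n) + 1)\<^sup>2 * (P * R) ^ Suc n * (\<epsilon> + \<delta>\<^sup>2)"
    by (simp add: algebra_simps power2_eq_square Q_def)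
  finally show ?case .
qed

end

section \<open>Trigonometric multipliers\<close>

text \<open>
  The kernel \<open>sin (r * a) / a\<close> of the variation of constants formula for a harmonic oscillator with
  frequency \<open>a\<close>, extended continuously to \<open>a = 0\<close>, and its primitive \<open>(1 - cos (r * a)) / a\<^sup>2\<close> with
  respect to \<open>r\<close>. The primitive produces the function \<open>sinc\<^sup>2 / 2\<close> with which the coefficient of the
  integrator is compared.
\<close>

definition sine_kernel :: "real \<Rightarrow> real \<Rightarrow> real" where
  "sine_kernel r a = r * sinc (r * a)"

definition sine_kernel_primitive :: "real \<Rightarrow> real \<Rightarrow> real" where
  "sine_kernel_primitive r a = r\<^sup>2 * ((sinc (r * a / 2))\<^sup>2 / 2)"

lemma sine_kernel_eq: "sine_kernel r a = (if a = 0 then r else sin (r * a) / a)"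
  by (simp add: sine_kernel_def)

lemma sine_kernel_primitive_eq:
  "sine_kernel_primitive r a = (if a = 0 then r\<^sup>2 / 2 else (1 - cos (r * a)) / a\<^sup>2)"
proof (cases "r = 0 \<or> a = 0")
  case False
  have "1 - cos (r * a) = 2 * (sin (r * a / 2))\<^sup>2"
    using cos_double_sin[of "r * a / 2"] by simp
  then show ?thesis
    using False by (simp add: sine_kernel_primitive_def power_divide power_mult_distrib)
qed (auto simp: sine_kernel_primitive_def)

lemma sine_kernel_0 [simp]: "sine_kernel 0 a = 0"
  and sine_kernel_primitive_0 [simp]: "sine_kernel_primitive 0 a = 0"
  by (simp_all add: sine_kernel_def sine_kernel_primitive_def)

lemma sine_kernel_has_real_derivative:
  "((\<lambda>\<tau>. sine_kernel (b - \<tau>) a) has_real_derivative - cos ((b - \<tau>) * a)) (at \<tau> within S)"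
  by (cases "a = 0") (auto simp: sine_kernel_eq intro!: derivative_eq_intros)

lemma sine_kernel_primitive_has_real_derivative:
  "((\<lambda>\<tau>. sine_kernel_primitive (b - \<tau>) a) has_real_derivative - sine_kernel (b - \<tau>) a) (at \<tau> within S)"
  by (cases "a = 0")
     (auto simp: sine_kernel_eq sine_kernel_primitive_eq power2_eq_square intro!: derivative_eq_intros)

lemma abs_sinc_le_1: "\<bar>sinc x\<bar> \<le> 1"
  using abs_sin_x_le_abs_x[of x] by (simp add: divide_le_eq)

lemma abs_sine_kernel_le: "\<bar>sine_kernel r a\<bar> \<le> \<bar>r\<bar>"
  unfolding sine_kernel_def abs_mult using abs_sinc_le_1 by (rule mult_left_le) simp

lemma abs_cos_minus_one_le: "\<bar>cos x - 1\<bar> \<le> x\<^sup>2" for x :: real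
proof -
  have "1 - cos x = 2 * (sin (x / 2))\<^sup>2" using cos_double_sin[of "x / 2"] by simp
  moreover have "(sin (x / 2))\<^sup>2 \<le> (x / 2)\<^sup>2"
    using abs_sin_x_le_abs_x[of "x / 2"] by (rule abs_le_square_iff[THEN iffD1])
  moreover have "(x / 2)\<^sup>2 = x\<^sup>2 / 4" by (simp add: power_divide)
  ultimately show ?thesis
    using zero_le_power2[of x] cos_le_one[of x] by linarith
qed

text \<open>
  For \<open>\<beta>\<close> between \<open>-1\<close> and \<open>0\<close> the power \<open>x powr \<beta>\<close> is at least the minimum of \<open>1\<close> and \<open>1 / x\<close>.
\<close>

lemma le_powr_if_le_1:
  fixes x :: real
  assumes "0 < x" "-1 \<le> \<beta>" "\<beta> \<le> 0" "0 \<le> u" "u \<le> 1" "u * x \<le> 1"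
  shows "u \<le> x powr \<beta>"
proof (cases "x \<le> 1")
  case True
  then have "x powr 0 \<le> x powr \<beta>" using assms by (intro powr_mono') auto
  then show ?thesis using assms by simp
next
  case False
  have "u \<le> x powr (-1)" using assms by (simp add: powr_minus field_simps)
  also have "\<dots> \<le> x powr \<beta>" using assms False by (intro powr_mono) auto
  finally show ?thesis .
qed

lemma has_vector_derivative_affine:
  fixes f :: "real \<Rightarrow> 'a::real_normed_vector"
  assumes "(f has_vector_derivative f') (at (m + c * x) within J)" "(\<lambda>x. m + c * x) ` S \<subseteq> J"
  shows "((\<lambda>x. f (m + c * x)) has_vector_derivative c *\<^sub>R f') (at x within S)"
proof -
  have "((\<lambda>x. m + c * x) has_vector_derivative c) (at x within S)"
    by (auto intro!: derivative_eq_intros simp: has_real_derivative_iff_has_vector_derivative[symmetric])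
  from vector_diff_chain_within[OF this has_vector_derivative_within_subset[OF assms]]
  show ?thesis by (simp add: o_def)
qed

context grid
begin

text \<open>
  The kernel gains one order of regularity. At frequency \<open>0\<close> it equals \<open>r\<close> and the weight is at
  most \<open>1\<close>; this is why step sizes are restricted to at most \<open>1\<close>.
\<close>

lemma abs_sine_kernel_mult_weight_le:
  assumes "j \<in> I" "0 \<le> r" "r \<le> 1"
  shows "\<bar>sine_kernel r (omega K j)\<bar> * w j \<le> 1"
proof (cases "j = 0")
  case True
  then have "\<bar>sine_kernel r (omega K j)\<bar> * w j = r * omega_min K"
    using assms by (simp add: sine_kernel_eq weight_0)
  also have "\<dots> \<le> 1 * 1"
    using assms omega_min_bounds by (intro mult_mono) auto
  finally show ?thesis by simp
next
  case False
  with assms have "w j = omega K j" "omega K j \<noteq> 0" "0 < omega K j"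
    using weight_nonzero[of j] weight_pos[of j] by auto
  then show ?thesis by (simp add: sine_kernel_eq)
qed

lemma abs_sine_kernel_le_powr:
  assumes "j \<in> I" "0 \<le> r" "r \<le> h" "0 < h" "h \<le> 1" "-1 \<le> \<beta>" "\<beta> \<le> 0"
  shows "\<bar>sine_kernel r (omega K j)\<bar> \<le> h * (h * w j) powr \<beta>"
proof -
  let ?k = "\<bar>sine_kernel r (omega K j)\<bar>"
  have "?k / h \<le> (h * w j) powr \<beta>"
  proof (rule le_powr_if_le_1)
    show "?k / h \<le> 1" using abs_sine_kernel_le[of r "omega K j"] assms by simp
    show "?k / h * (h * w j) \<le> 1"
      using abs_sine_kernel_mult_weight_le[of j r] assms by simp
  qed (use assms in auto)
  then show ?thesis using assms by (simp add: field_simps)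
qed

lemma abs_cos_minus_one_le_powr:
  assumes "0 \<le> r" "r \<le> h" "0 < h" "0 \<le> \<theta>" "\<theta> \<le> 2"
  shows "\<bar>cos (r * omega K j) - 1\<bar> \<le> 2 * (h * w j) powr \<theta>"
proof (cases "1 \<le> h * w j")
  case True
  have "\<bar>cos (r * omega K j) - 1\<bar> \<le> 2"
    using cos_ge_minus_one[of "r * omega K j"] cos_le_one[of "r * omega K j"] by linarith
  also have "\<dots> \<le> 2 * (h * w j) powr \<theta>"
    using ge_one_powr_ge_zero[OF True assms(4)] by simp
  finally show ?thesis .
next
  case False
  have "\<bar>cos (r * omega K j) - 1\<bar> \<le> (r * omega K j)\<^sup>2" by (rule abs_cos_minus_one_le)
  also have "\<dots> \<le> (h * w j)\<^sup>2"
    using assms omega_le_weight[of j] by (intro power_mono mult_mono) auto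
  also have "\<dots> = (h * w j) powr 2" using assms by simp
  also have "\<dots> \<le> (h * w j) powr \<theta>" using assms False by (intro powr_mono') auto
  also have "\<dots> \<le> 2 * (h * w j) powr \<theta>" by simp
  finally show ?thesis .
qed

lemma half_sinc_squared_le_powr:
  assumes "j \<in> I" "0 < h" "h \<le> 1" "-1 \<le> \<beta>" "\<beta> \<le> 0"
  shows "\<bar>(sinc (h * omega K j / 2))\<^sup>2 / 2\<bar> \<le> (h * w j) powr \<beta>"
proof -
  define c where "c = sinc (h * omega K j / 2)"
  have c1: "\<bar>c\<bar> \<le> 1" unfolding c_def by (rule abs_sinc_le_1)
  have "h / 2 * c = sine_kernel (h / 2) (omega K j)"
    by (simp add: sine_kernel_def c_def)
  with abs_sine_kernel_mult_weight_le[of j "h / 2"] assms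
  have "\<bar>h / 2 * c\<bar> * w j \<le> 1" by simp
  then have k: "\<bar>c\<bar> * (h * w j) \<le> 2" using assms by (simp add: abs_mult mult_ac)
  have "\<bar>c\<^sup>2 / 2\<bar> \<le> (h * w j) powr \<beta>"
  proof (rule le_powr_if_le_1)
    have "c\<^sup>2 \<le> 1" using c1 by (simp add: abs_square_le_1)
    then show "\<bar>c\<^sup>2 / 2\<bar> \<le> 1" by simp
    have "\<bar>c\<^sup>2 / 2\<bar> * (h * w j) = (\<bar>c\<bar> / 2) * (\<bar>c\<bar> * (h * w j))"
      by (simp add: power2_eq_square)
    also have "\<dots> \<le> (1 / 2) * 2"
      using c1 k assms by (intro mult_mono) auto
    finally show "\<bar>c\<^sup>2 / 2\<bar> * (h * w j) \<le> 1" by simp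
  qed (use assms in auto)
  then show ?thesis by (simp only: c_def)
qed

lemma erkn_half_eq:
  "erkn_half K h y v j = of_real (cos (h / 2 * omega K j)) * y j
     + of_real (sine_kernel (h / 2) (omega K j)) * v j"
  by (simp add: erkn_half_def sine_kernel_def)

lemma norm_new_sine_kernel:
  assumes "0 \<le> r" "r \<le> 1"
  shows "N (\<sigma> + 1) (\<lambda>j. of_real (sine_kernel r (omega K j)) * y j) \<le> N \<sigma> y"
proof -
  have "\<bar>sine_kernel r (omega K j)\<bar> \<le> 1 * (1 * w j) powr (- 1)" if "j \<in> I" for j
    using abs_sine_kernel_mult_weight_le[OF that assms] by (simp add: powr_minus field_simps)
  from norm_new_multiplier[OF this, of \<sigma> y] show ?thesis by simp
qed

lemma norm_new_erkn_half:
  assumes "0 \<le> h" "h \<le> 1"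
  shows "N (\<sigma> + 1) (erkn_half K h y v) \<le> N (\<sigma> + 1) y + N \<sigma> v"
proof -
  have "N (\<sigma> + 1) (\<lambda>j. of_real (cos (h / 2 * omega K j)) * y j) \<le> 1 * N (\<sigma> + 1) y"
    by (rule norm_new_bounded_multiplier) auto
  moreover have "N (\<sigma> + 1) (\<lambda>j. of_real (sine_kernel (h / 2) (omega K j)) * v j) \<le> N \<sigma> v"
    using assms by (intro norm_new_sine_kernel) auto
  ultimately show ?thesis
    unfolding erkn_half_eq[abs_def] by (intro order_trans[OF norm_new_triangle]) auto
qed

end

section \<open>The nonlinearity and the exact solution\<close>

lemma has_vector_derivative_of_real_mult:
  fixes g :: "real \<Rightarrow> complex"
  assumes "(c has_real_derivative c') (at x within S)" "(g has_vector_derivative g') (at x within S)"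
  shows "((\<lambda>x. of_real (c x) * g x) has_vector_derivative (of_real (c x) * g' + of_real c' * g x)) (at x within S)"
  using has_vector_derivative_scaleR[OF assms] by (simp add: scaleR_conv_of_real)

text \<open>
  A common bound for the size, the Lipschitz constant and the second difference constant of the
  nonlinearity on a ball of radius \<open>R \<ge> 1\<close>.
\<close>

definition nonlin_const :: "real \<Rightarrow> nat \<Rightarrow> real \<Rightarrow> real" where
  "nonlin_const s p R = (real (p - 1) + 1)\<^sup>2 * (product_const s * R) ^ (p - 1) * R"

context smooth_grid
begin

lemma nonlin_eq: "nonlin K p y = conv_power K (p - 1) y"
  by (simp add: nonlin_def conv_power_def)

lemma nonlin_const_bounds:
  assumes "1 \<le> R"
  shows "1 \<le> nonlin_const s p R"
    "(P * R) ^ (p - 1) * R \<le> nonlin_const s p R"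
    "(real (p - 1) + 1) * (P * R) ^ (p - 1) \<le> nonlin_const s p R"
    "(real (p - 1) + 1)\<^sup>2 * (P * R) ^ (p - 1) \<le> nonlin_const s p R"
proof -
  let ?n = "real (p - 1) + 1" and ?B = "(P * R) ^ (p - 1)"
  have B: "1 \<le> ?B" using P_ge_1 assms by (intro one_le_power) (simp add: mult_ge1_I)
  have n: "1 \<le> ?n\<^sup>2" "?n \<le> ?n\<^sup>2" by (auto intro!: one_le_power self_le_power)
  have "?n\<^sup>2 * ?B * 1 \<le> ?n\<^sup>2 * ?B * R" using B assms by (intro mult_left_mono) auto
  then show 4: "?n\<^sup>2 * ?B \<le> nonlin_const s p R" by (simp add: nonlin_const_def)
  have "?n * ?B \<le> ?n\<^sup>2 * ?B" using B n by (intro mult_right_mono) auto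
  with 4 show 3: "?n * ?B \<le> nonlin_const s p R" by linarith
  have "1 * ?B * R \<le> ?n\<^sup>2 * ?B * R" using B n assms by (intro mult_right_mono) auto
  then show 2: "?B * R \<le> nonlin_const s p R" by (simp add: nonlin_const_def)
  have "1 * 1 \<le> ?B * R" using B assms by (intro mult_mono) auto
  with 2 show "1 \<le> nonlin_const s p R" by linarith
qed

lemma norm_new_nonlin:
  assumes "N (s + 1) y \<le> R" "1 \<le> R"
  shows "N (s + 1) (nonlin K p y) \<le> nonlin_const s p R"
  unfolding nonlin_eq using norm_new_conv_power[OF assms] nonlin_const_bounds(2)[OF assms(2)]
  by (rule order_trans)

lemma norm_new_nonlin_diff:
  assumes "\<bar>\<tau>\<bar> \<le> s + 1" "N (s + 1) y \<le> R" "N (s + 1) z \<le> R" "1 \<le> R"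
  shows "N \<tau> (\<lambda>j. nonlin K p y j - nonlin K p z j) \<le> nonlin_const s p R * N \<tau> (\<lambda>j. y j - z j)"
  unfolding nonlin_eq
  by (rule order_trans[OF norm_new_conv_power_diff[OF assms]])
     (intro mult_right_mono nonlin_const_bounds assms norm_new_nonneg)

lemma norm_new_nonlin_second_diff:
  assumes "N (s + 1) u \<le> R" "N (s + 1) v \<le> R" "N (s + 1) z \<le> R" "1 \<le> R"
    and "N s (\<lambda>j. u j - z j) \<le> \<delta>" "N s (\<lambda>j. v j - z j) \<le> \<delta>"
    and "N (s - 1) (\<lambda>j. u j + v j - 2 * z j) \<le> \<epsilon>"
  shows "N (s - 1) (\<lambda>j. nonlin K p u j + nonlin K p v j - 2 * nonlin K p z j)
    \<le> nonlin_const s p R * (\<epsilon> + \<delta>\<^sup>2)"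
proof -
  have "0 \<le> \<epsilon>" using order_trans[OF norm_new_nonneg assms(7)] .
  then show ?thesis
    unfolding nonlin_eq
    by (intro order_trans[OF norm_new_conv_power_second_diff[OF assms]] mult_right_mono
        nonlin_const_bounds assms add_nonneg_nonneg) auto
qed

end

text \<open>
  Here \<open>S\<close> bounds the second derivative of the exact solution at order \<open>s - 1\<close>.
\<close>

definition defect_const :: "real \<Rightarrow> nat \<Rightarrow> real \<Rightarrow> real" where
  "defect_const s p R = (let G = nonlin_const s p R; S = R + 4 * G in G * (8 + S + S\<^sup>2))"

text \<open>
  The exact solution stays at distance \<open>1\<close> inside the ball of radius \<open>R\<close>, so that the stages of
  a numerical solution with a small error still lie in the ball.
\<close>

locale regular_solution = smooth_grid +
  fixes p :: nat and t0 T :: real and y v :: "real \<Rightarrow> int \<Rightarrow> complex" and R :: real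
  assumes solution: "semidiscrete_solution K p t0 T y v"
    and R_ge_1: "1 \<le> R"
    and regular: "t \<in> {t0..t0 + T} \<Longrightarrow> N (s + 1) (y t) + N s (v t) \<le> R - 1"
begin

abbreviation "J \<equiv> {t0..t0 + T}"
abbreviation "f \<equiv> nonlin K p"
abbreviation "G \<equiv> nonlin_const s p R"
abbreviation "S \<equiv> R + 4 * G"

lemma G_ge_1: "1 \<le> G"
  by (rule nonlin_const_bounds(1)[OF R_ge_1])

lemma position_le: "t \<in> J \<Longrightarrow> N (s + 1) (y t) \<le> R"
  and velocity_le: "t \<in> J \<Longrightarrow> N s (v t) \<le> R"
  using regular[of t] norm_new_nonneg[of "s + 1" "y t"] norm_new_nonneg[of s "v t"] by linarith+

lemma force_le: "t \<in> J \<Longrightarrow> N (s + 1) (f (y t)) \<le> G"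
  by (rule norm_new_nonlin[OF position_le R_ge_1])

lemma position_derivative:
  "t \<in> J \<Longrightarrow> j \<in> I \<Longrightarrow> ((\<lambda>\<tau>. y \<tau> j) has_vector_derivative v t j) (at t within J)"
  and velocity_derivative:
  "t \<in> J \<Longrightarrow> j \<in> I \<Longrightarrow> ((\<lambda>\<tau>. v \<tau> j) has_vector_derivative
     (- of_real ((omega K j)\<^sup>2) * y t j + f (y t) j)) (at t within J)"
  using solution unfolding semidiscrete_solution_def by blast+

text \<open>
  Transporting the solution from \<open>\<tau>\<close> to the fixed time \<open>b\<close> by the linear flow leaves only the
  nonlinearity in the derivative: this is the variation of constants formula in differential form.
\<close>

lemma flow_position_derivative:
  assumes "t \<in> J" "j \<in> I"
  shows "((\<lambda>\<tau>. of_real (cos ((b - \<tau>) * omega K j)) * y \<tau> j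
      + of_real (sine_kernel (b - \<tau>) (omega K j)) * v \<tau> j)
    has_vector_derivative of_real (sine_kernel (b - t) (omega K j)) * f (y t) j) (at t within J)"
proof -
  let ?a = "omega K j"
  have c: "((\<lambda>\<tau>. cos ((b - \<tau>) * ?a)) has_real_derivative ?a * sin ((b - t) * ?a)) (at t within J)"
    by (auto intro!: derivative_eq_intros)
  have "?a * sin ((b - t) * ?a) = sine_kernel (b - t) ?a * ?a\<^sup>2"
    by (simp add: sine_kernel_eq power2_eq_square)
  then have a: "complex_of_real (?a * sin ((b - t) * ?a)) = of_real (sine_kernel (b - t) ?a) * of_real (?a\<^sup>2)"
    by (metis of_real_mult)
  show ?thesis
    by (rule has_vector_derivative_eq_rhs[OF has_vector_derivative_add[OF
          has_vector_derivative_of_real_mult[OF c position_derivative[OF assms]]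
          has_vector_derivative_of_real_mult[OF sine_kernel_has_real_derivative velocity_derivative[OF assms]]]])
       (simp only: a, simp add: algebra_simps)
qed

lemma flow_velocity_derivative:
  assumes "t \<in> J" "j \<in> I"
  shows "((\<lambda>\<tau>. of_real (- omega K j * sin ((b - \<tau>) * omega K j)) * y \<tau> j
      + of_real (cos ((b - \<tau>) * omega K j)) * v \<tau> j)
    has_vector_derivative of_real (cos ((b - t) * omega K j)) * f (y t) j) (at t within J)"
proof -
  let ?a = "omega K j"
  have c: "((\<lambda>\<tau>. cos ((b - \<tau>) * ?a)) has_real_derivative ?a * sin ((b - t) * ?a)) (at t within J)"
    by (auto intro!: derivative_eq_intros)
  have s: "((\<lambda>\<tau>. - ?a * sin ((b - \<tau>) * ?a)) has_real_derivative ?a\<^sup>2 * cos ((b - t) * ?a)) (at t within J)"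
    by (auto intro!: derivative_eq_intros simp: power2_eq_square)
  show ?thesis
    by (rule has_vector_derivative_eq_rhs[OF has_vector_derivative_add[OF
          has_vector_derivative_of_real_mult[OF s position_derivative[OF assms]]
          has_vector_derivative_of_real_mult[OF c velocity_derivative[OF assms]]]])
       (simp add: algebra_simps)
qed

text \<open>
  Over a time \<open>r\<close> the nonlinearity contributes an integral over an interval of length \<open>r\<close> with a
  kernel of size at most \<open>r\<close>. With \<open>r = h / 2\<close> this is the error of the stage, which therefore is
  quadratic in \<open>h\<close> without loss of regularity.
\<close>

lemma half_step_error:
  assumes "0 \<le> r" "t \<in> J" "t + r \<in> J"
  shows "N (s + 1) (\<lambda>j. y (t + r) j - (of_real (cos (r * omega K j)) * y t j
     + of_real (sine_kernel r (omega K j)) * v t j)) \<le> r\<^sup>2 * G"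
proof -
  define X where "X \<tau> j = of_real (cos ((t + r - \<tau>) * omega K j)) * y \<tau> j
      + of_real (sine_kernel (t + r - \<tau>) (omega K j)) * v \<tau> j" for \<tau> j
  have sub: "{t..t + r} \<subseteq> J" using assms by auto
  have "N (s + 1) (\<lambda>j. X (t + r) j - X t j) \<le> r * G * (t + r - t)"
  proof (rule norm_new_mean_value)
    fix \<tau> j assume \<tau>: "\<tau> \<in> {t..t + r}" and j: "j \<in> I"
    show "((\<lambda>\<tau>. X \<tau> j) has_vector_derivative
        of_real (sine_kernel (t + r - \<tau>) (omega K j)) * f (y \<tau>) j) (at \<tau> within {t..t + r})"
      unfolding X_def
      using flow_position_derivative[OF subsetD[OF sub \<tau>] j] sub
      by (rule has_vector_derivative_within_subset)
  next
    fix \<tau> assume \<tau>: "\<tau> \<in> {t..t + r}"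
    have "N (s + 1) (\<lambda>j. of_real (sine_kernel (t + r - \<tau>) (omega K j)) * f (y \<tau>) j) \<le> r * N (s + 1) (f (y \<tau>))"
      using abs_sine_kernel_le[of "t + r - \<tau>"] \<tau> assms
      by (intro norm_new_bounded_multiplier order_trans[OF abs_sine_kernel_le]) auto
    also have "\<dots> \<le> r * G"
      using force_le[OF subsetD[OF sub \<tau>]] assms by (intro mult_left_mono) auto
    finally show "N (s + 1) (\<lambda>j. of_real (sine_kernel (t + r - \<tau>) (omega K j)) * f (y \<tau>) j) \<le> r * G" .
  qed (use assms in simp)
  then show ?thesis by (simp add: X_def power2_eq_square mult_ac)
qed

lemma position_lipschitz:
  assumes "a \<in> J" "b \<in> J" "a \<le> b"
  shows "N s (\<lambda>j. y b j - y a j) \<le> R * (b - a)"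
proof (rule norm_new_mean_value[OF assms(3)])
  have sub: "{a..b} \<subseteq> J" using assms by auto
  show "((\<lambda>\<tau>. y \<tau> j) has_vector_derivative v \<tau> j) (at \<tau> within {a..b})" if "\<tau> \<in> {a..b}" "j \<in> I" for \<tau> j
    using position_derivative[OF subsetD[OF sub that(1)] that(2)] sub
    by (rule has_vector_derivative_within_subset)
  show "N s (v \<tau>) \<le> R" if "\<tau> \<in> {a..b}" for \<tau>
    using velocity_le subsetD[OF sub that] .
qed

lemma velocity_lipschitz:
  assumes "a \<in> J" "b \<in> J" "a \<le> b"
  shows "N (s - 1) (\<lambda>j. v b j - v a j) \<le> S * (b - a)"
proof (rule norm_new_mean_value[OF assms(3)])
  have sub: "{a..b} \<subseteq> J" using assms by auto
  show "((\<lambda>\<tau>. v \<tau> j) has_vector_derivative (- of_real ((omega K j)\<^sup>2) * y \<tau> j + f (y \<tau>) j))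
      (at \<tau> within {a..b})" if "\<tau> \<in> {a..b}" "j \<in> I" for \<tau> j
    using velocity_derivative[OF subsetD[OF sub that(1)] that(2)] sub
    by (rule has_vector_derivative_within_subset)
  show "N (s - 1) (\<lambda>j. - of_real ((omega K j)\<^sup>2) * y \<tau> j + f (y \<tau>) j) \<le> S" if "\<tau> \<in> {a..b}" for \<tau>
  proof -
    have \<tau>: "\<tau> \<in> J" using subsetD[OF sub that] .
    have "N (s + 1 - 2) (\<lambda>j. of_real (- (omega K j)\<^sup>2) * y \<tau> j) \<le> 1 * 1 powr 2 * N (s + 1) (y \<tau>)"
    proof (rule norm_new_multiplier)
      fix j
      have "(omega K j)\<^sup>2 \<le> (w j)\<^sup>2" using omega_le_weight by (intro power_mono) auto
      then show "\<bar>- (omega K j)\<^sup>2\<bar> \<le> 1 * (1 * w j) powr 2" by simp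
    qed auto
    moreover have "N (s - 1) (f (y \<tau>)) \<le> 2 powr (s + 1 - (s - 1)) * N (s + 1) (f (y \<tau>))"
      by (rule norm_new_lower_order) simp
    ultimately show ?thesis
      using position_le[OF \<tau>] force_le[OF \<tau>]
        norm_new_triangle[of "s - 1" "\<lambda>j. of_real (- (omega K j)\<^sup>2) * y \<tau> j" "f (y \<tau>)"]
      by simp
  qed
qed

text \<open>
  Since the second derivative is bounded at order \<open>s - 1\<close>, symmetric second differences are
  quadratic in the length of the step there.
\<close>

lemma position_second_difference:
  assumes "m - r \<in> J" "m + r \<in> J" "0 \<le> r"
  shows "N (s - 1) (\<lambda>j. y (m + r) j + y (m - r) j - 2 * y m j) \<le> 2 * S * r\<^sup>2"
proof -
  \<comment> \<open>The factors \<open>1\<close> and \<open>- 1\<close> match the form \<open>m + c * r\<close> of the chain rule for affine maps.\<close>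
  define X where "X \<tau> j = y (m + 1 * \<tau>) j + y (m + (- 1) * \<tau>) j" for \<tau> j
  have sub: "m + \<tau> \<in> J" "m - \<tau> \<in> J" if "\<tau> \<in> {0..r}" for \<tau> using assms that by auto
  have "N (s - 1) (\<lambda>j. X r j - X 0 j) \<le> (S * (2 * r)) * (r - 0)"
  proof (rule norm_new_mean_value[OF assms(3)])
    fix \<tau> j assume \<tau>: "\<tau> \<in> {0..r}" and j: "j \<in> I"
    have "((\<lambda>\<tau>. X \<tau> j) has_vector_derivative (1 *\<^sub>R v (m + 1 * \<tau>) j + (- 1) *\<^sub>R v (m + (- 1) * \<tau>) j))
        (at \<tau> within {0..r})"
      unfolding X_def
      by (intro has_vector_derivative_add has_vector_derivative_affine[where J = J] position_derivative j)
         (use assms \<tau> in auto)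
    then show "((\<lambda>\<tau>. X \<tau> j) has_vector_derivative (v (m + \<tau>) j - v (m - \<tau>) j)) (at \<tau> within {0..r})"
      by simp
  next
    fix \<tau> assume \<tau>: "\<tau> \<in> {0..r}"
    have "N (s - 1) (\<lambda>j. v (m + \<tau>) j - v (m - \<tau>) j) \<le> S * (m + \<tau> - (m - \<tau>))"
      using sub[OF \<tau>] \<tau> by (intro velocity_lipschitz) auto
    also have "\<dots> \<le> S * (2 * r)"
      using \<tau> R_ge_1 G_ge_1 by (intro mult_left_mono) auto
    finally show "N (s - 1) (\<lambda>j. v (m + \<tau>) j - v (m - \<tau>) j) \<le> S * (2 * r)" .
  qed
  then show ?thesis by (simp add: X_def power2_eq_square mult_ac)
qed

end

section \<open>Local error\<close>

locale regular_step = regular_solution +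
  fixes t h :: real
  assumes h_pos: "0 < h" and h_le_1: "h \<le> 1" and t_in: "t \<in> J" and th_in: "t + h \<in> J"
begin

abbreviation "z \<equiv> erkn_half K h (y t) (v t)"
abbreviation "m \<equiv> t + h / 2"

lemma in_J: "\<tau> \<in> {t..t + h} \<Longrightarrow> \<tau> \<in> J"
  using t_in th_in by auto

lemma m_in: "m \<in> J"
  using h_pos by (intro in_J) auto

lemma stage_le: "N (s + 1) z \<le> R - 1"
  using norm_new_erkn_half[of h s "y t" "v t"] regular[OF t_in] h_pos h_le_1 by linarith

lemma stage_le': "N (s + 1) z \<le> R"
  using stage_le by linarith

lemma stage_error: "N (s + 1) (\<lambda>j. y m j - z j) \<le> (h / 2)\<^sup>2 * G"
  unfolding erkn_half_eq using h_pos t_in m_in by (intro half_step_error) auto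

lemma stage_error_lower: "N s (\<lambda>j. y m j - z j) \<le> G * h"
  and stage_error_lower2: "N (s - 1) (\<lambda>j. y m j - z j) \<le> G * h\<^sup>2"
proof -
  have sq: "h\<^sup>2 \<le> h" using h_pos h_le_1 by (simp add: power2_eq_square mult_left_le)
  have "N s (\<lambda>j. y m j - z j) \<le> 2 powr (s + 1 - s) * ((h / 2)\<^sup>2 * G)"
    by (rule order_trans[OF norm_new_lower_order[of s "s + 1"] mult_left_mono[OF stage_error]]) auto
  also have "\<dots> = G * (h\<^sup>2 / 2)" by (simp add: power_divide)
  also have "\<dots> \<le> G * h" using G_ge_1 sq h_pos by (intro mult_left_mono) auto
  finally show "N s (\<lambda>j. y m j - z j) \<le> G * h" .
  have "N (s - 1) (\<lambda>j. y m j - z j) \<le> 2 powr (s + 1 - (s - 1)) * ((h / 2)\<^sup>2 * G)"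
    by (rule order_trans[OF norm_new_lower_order[of "s - 1" "s + 1"] mult_left_mono[OF stage_error]]) auto
  also have "\<dots> = G * h\<^sup>2" by (simp add: power_divide)
  finally show "N (s - 1) (\<lambda>j. y m j - z j) \<le> G * h\<^sup>2" .
qed

text \<open>
  The approximate stage can replace the exact midpoint in first differences, and by the next
  lemma also in second differences, because the error of the stage is quadratic in \<open>h\<close>.
\<close>

lemma position_near_stage:
  assumes \<tau>: "\<tau> \<in> {t..t + h}"
  shows "N s (\<lambda>j. y \<tau> j - z j) \<le> S * h"
proof -
  have "N s (\<lambda>j. y \<tau> j - y m j) \<le> R * h"
  proof (cases "m \<le> \<tau>")
    case True
    have "N s (\<lambda>j. y \<tau> j - y m j) \<le> R * (\<tau> - m)"
      using True \<tau> m_in in_J[OF \<tau>] by (intro position_lipschitz) auto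
    also have "\<dots> \<le> R * h" using \<tau> R_ge_1 h_pos by (intro mult_left_mono) auto
    finally show ?thesis .
  next
    case False
    have "N s (\<lambda>j. y m j - y \<tau> j) \<le> R * (m - \<tau>)"
      using False \<tau> m_in in_J[OF \<tau>] by (intro position_lipschitz) auto
    also have "\<dots> \<le> R * h" using \<tau> R_ge_1 h_pos by (intro mult_left_mono) auto
    finally show ?thesis by (subst norm_new_diff_commute)
  qed
  moreover have "N s (\<lambda>j. y \<tau> j - z j) \<le> N s (\<lambda>j. y \<tau> j - y m j) + N s (\<lambda>j. y m j - z j)"
    using norm_new_triangle[of s "\<lambda>j. y \<tau> j - y m j" "\<lambda>j. y m j - z j"] by simp
  ultimately have "N s (\<lambda>j. y \<tau> j - z j) \<le> (R + G) * h"
    using stage_error_lower by (simp add: distrib_right)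
  also have "\<dots> \<le> S * h" using G_ge_1 h_pos by (intro mult_right_mono) auto
  finally show ?thesis .
qed

lemma position_second_difference_stage:
  assumes r: "r \<in> {0..h / 2}"
  shows "N (s - 1) (\<lambda>j. y (m + r) j + y (m - r) j - 2 * z j) \<le> S * h\<^sup>2"
proof -
  have mr: "m + r \<in> J" "m - r \<in> J" using r by (auto intro!: in_J simp del: atLeastAtMost_iff) (auto)
  have "N (s - 1) (\<lambda>j. y (m + r) j + y (m - r) j - 2 * z j)
      = N (s - 1) (\<lambda>j. (y (m + r) j + y (m - r) j - 2 * y m j) + of_real 2 * (y m j - z j))"
    by (simp add: algebra_simps)
  also have "\<dots> \<le> N (s - 1) (\<lambda>j. y (m + r) j + y (m - r) j - 2 * y m j) + 2 * N (s - 1) (\<lambda>j. y m j - z j)"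
    by (rule order_trans[OF norm_new_triangle])
       (simp only: norm_new_scale abs_numeral order_refl)
  also have "\<dots> \<le> 2 * S * r\<^sup>2 + 2 * (G * h\<^sup>2)"
    using mr r by (intro add_mono mult_left_mono position_second_difference stage_error_lower2) auto
  also have "\<dots> \<le> 2 * S * (h / 2)\<^sup>2 + 2 * (G * h\<^sup>2)"
    using r R_ge_1 G_ge_1 by (intro add_mono mult_left_mono power_mono) auto
  also have "\<dots> = (R / 2 + 4 * G) * h\<^sup>2" by (simp add: power_divide algebra_simps)
  also have "\<dots> \<le> S * h\<^sup>2" using R_ge_1 by (intro mult_right_mono) auto
  finally show ?thesis .
qed

lemma force_near_stage:
  assumes \<tau>: "\<tau> \<in> {t..t + h}"
  shows "N s (\<lambda>j. f (y \<tau>) j - f z j) \<le> G * (S * h)"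
    "N (s + 1) (\<lambda>j. f (y \<tau>) j - f z j) \<le> 2 * G"
proof -
  have "N s (\<lambda>j. f (y \<tau>) j - f z j) \<le> G * N s (\<lambda>j. y \<tau> j - z j)"
    using s_nonneg by (intro norm_new_nonlin_diff position_le in_J \<tau> stage_le' R_ge_1) auto
  also have "\<dots> \<le> G * (S * h)"
    using G_ge_1 position_near_stage[OF \<tau>] by (intro mult_left_mono) auto
  finally show "N s (\<lambda>j. f (y \<tau>) j - f z j) \<le> G * (S * h)" .
  show "N (s + 1) (\<lambda>j. f (y \<tau>) j - f z j) \<le> 2 * G"
    using norm_new_diff_triangle[of "s + 1" "f (y \<tau>)" "f z"] force_le[OF in_J[OF \<tau>]]
      norm_new_nonlin[OF stage_le' R_ge_1, of p] by linarith
qed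

lemma force_second_difference_stage:
  assumes r: "r \<in> {0..h / 2}"
  shows "N (s - 1) (\<lambda>j. f (y (m + r)) j + f (y (m - r)) j - 2 * f z j) \<le> G * (S + S\<^sup>2) * h\<^sup>2"
    "N (s + 1) (\<lambda>j. f (y (m + r)) j + f (y (m - r)) j - 2 * f z j) \<le> 4 * G"
proof -
  have i: "m + r \<in> {t..t + h}" "m - r \<in> {t..t + h}" using r by auto
  have "N (s - 1) (\<lambda>j. f (y (m + r)) j + f (y (m - r)) j - 2 * f z j) \<le> G * (S * h\<^sup>2 + (S * h)\<^sup>2)"
    by (intro norm_new_nonlin_second_diff position_le in_J i stage_le' R_ge_1 position_near_stage
        position_second_difference_stage r)
  also have "\<dots> = G * (S + S\<^sup>2) * h\<^sup>2" by (simp add: power2_eq_square algebra_simps)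
  finally show "N (s - 1) (\<lambda>j. f (y (m + r)) j + f (y (m - r)) j - 2 * f z j) \<le> G * (S + S\<^sup>2) * h\<^sup>2" .
  have "N (s + 1) (\<lambda>j. (f (y (m + r)) j - f z j) + (f (y (m - r)) j - f z j)) \<le> 2 * G + 2 * G"
    by (rule order_trans[OF norm_new_triangle add_mono[OF force_near_stage(2)[OF i(1)] force_near_stage(2)[OF i(2)]]])
  then show "N (s + 1) (\<lambda>j. f (y (m + r)) j + f (y (m - r)) j - 2 * f z j) \<le> 4 * G"
    by (simp add: algebra_simps)
qed

abbreviation "D \<equiv> defect_const s p R"

lemma D_eq: "D = G * (8 + S + S\<^sup>2)"
  by (simp add: defect_const_def Let_def)

text \<open>
  Freezing the nonlinearity at the stage in the variation of constants formula gives the coefficient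
  \<open>sinc\<^sup>2 / 2\<close>. The remaining difference is bounded at order \<open>s + 1\<close> and of size \<open>h\<close> at order \<open>s\<close>;
  interpolation gives \<open>h powr \<alpha>\<close> if \<open>\<alpha> \<ge> 0\<close>, and for negative \<open>\<alpha>\<close> the smoothing by the kernel
  provides the missing regularity.
\<close>

lemma position_quadrature_error:
  assumes \<alpha>: "-1 \<le> \<alpha>" "\<alpha> \<le> 1"
  shows "N (s + 1 - \<alpha>) (\<lambda>j. y (t + h) j - (of_real (cos (h * omega K j)) * y t j
      + of_real (sine_kernel h (omega K j)) * v t j
      + of_real (sine_kernel_primitive h (omega K j)) * f z j)) \<le> D * (h\<^sup>2 * h powr \<alpha>)"
proof -
  define X where "X \<tau> j = (of_real (cos ((t + h - \<tau>) * omega K j)) * y \<tau> j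
      + of_real (sine_kernel (t + h - \<tau>) (omega K j)) * v \<tau> j)
      + of_real (sine_kernel_primitive (t + h - \<tau>) (omega K j)) * f z j" for \<tau> j
  define \<Delta> where "\<Delta> \<tau> j = f (y \<tau>) j - f z j" for \<tau> j
  have sub: "{t..t + h} \<subseteq> J" using in_J by auto
  have "N (s + 1 - \<alpha>) (\<lambda>j. X (t + h) j - X t j) \<le> D * (h * h powr \<alpha>) * (t + h - t)"
  proof (rule norm_new_mean_value)
    fix \<tau> j assume \<tau>: "\<tau> \<in> {t..t + h}" and j: "j \<in> I"
    have "((\<lambda>\<tau>. X \<tau> j) has_vector_derivative
        (of_real (sine_kernel (t + h - \<tau>) (omega K j)) * f (y \<tau>) j
         + (of_real (sine_kernel_primitive (t + h - \<tau>) (omega K j)) * 0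
            + of_real (- sine_kernel (t + h - \<tau>) (omega K j)) * f z j))) (at \<tau> within J)"
      unfolding X_def
      by (intro has_vector_derivative_add flow_position_derivative in_J \<tau> j
          has_vector_derivative_of_real_mult sine_kernel_primitive_has_real_derivative has_vector_derivative_const)
    then have "((\<lambda>\<tau>. X \<tau> j) has_vector_derivative
        of_real (sine_kernel (t + h - \<tau>) (omega K j)) * \<Delta> \<tau> j) (at \<tau> within J)"
      by (simp add: \<Delta>_def right_diff_distrib)
    then show "((\<lambda>\<tau>. X \<tau> j) has_vector_derivative
        of_real (sine_kernel (t + h - \<tau>) (omega K j)) * \<Delta> \<tau> j) (at \<tau> within {t..t + h})"
      using sub by (rule has_vector_derivative_within_subset)
  next
    fix \<tau> assume \<tau>: "\<tau> \<in> {t..t + h}"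
    let ?k = "\<lambda>j. sine_kernel (t + h - \<tau>) (omega K j)"
    have \<Delta>: "N s (\<Delta> \<tau>) \<le> G * (S * h)" "N (s + 1) (\<Delta> \<tau>) \<le> 2 * G"
      using force_near_stage[OF \<tau>] by (simp_all add: \<Delta>_def[abs_def])
    have "N (s + 1 - \<alpha>) (\<lambda>j. of_real (?k j) * \<Delta> \<tau> j) \<le> (2 * G + G * S) * (h * h powr \<alpha>)"
    proof (cases "0 \<le> \<alpha>")
      case True
      have "N (s + 1 - \<alpha>) (\<lambda>j. of_real (?k j) * \<Delta> \<tau> j) \<le> h * N (s + 1 - \<alpha>) (\<Delta> \<tau>)"
        using \<tau> h_pos by (intro norm_new_bounded_multiplier order_trans[OF abs_sine_kernel_le]) auto
      also have "\<dots> \<le> h * (h powr \<alpha> * (N (s + 1) (\<Delta> \<tau>) + N (s + 1 - 1) (\<Delta> \<tau>) / h powr 1))"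
        using h_pos True \<alpha> by (intro mult_left_mono norm_new_interpolate) auto
      also have "\<dots> \<le> h * (h powr \<alpha> * (2 * G + G * (S * h) / h powr 1))"
        using h_pos \<Delta> by (intro mult_left_mono add_mono divide_right_mono) auto
      also have "\<dots> = (2 * G + G * S) * (h * h powr \<alpha>)" using h_pos by simp
      finally show ?thesis .
    next
      case False
      have "N (s + 1 - \<alpha>) (\<lambda>j. of_real (?k j) * \<Delta> \<tau> j) \<le> h * h powr \<alpha> * N (s + 1) (\<Delta> \<tau>)"
        using \<tau> h_pos h_le_1 False \<alpha> by (intro norm_new_multiplier abs_sine_kernel_le_powr) auto
      also have "\<dots> \<le> h * h powr \<alpha> * (2 * G + G * S)"
        using \<Delta> h_pos G_ge_1 R_ge_1 by (intro mult_left_mono) (auto intro: order_trans simp: add_increasing2)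
      finally show ?thesis by (simp add: mult_ac)
    qed
    also have "\<dots> \<le> D * (h * h powr \<alpha>)"
    proof (intro mult_right_mono)
      have "0 \<le> G * (6 + S\<^sup>2)" using G_ge_1 by simp
      then show "2 * G + G * S \<le> D" by (simp add: D_eq algebra_simps)
    qed (use h_pos in auto)
    finally show "N (s + 1 - \<alpha>) (\<lambda>j. of_real (?k j) * \<Delta> \<tau> j) \<le> D * (h * h powr \<alpha>)" .
  qed (use h_pos in simp)
  moreover have "X (t + h) j - X t j = y (t + h) j - (of_real (cos (h * omega K j)) * y t j
      + of_real (sine_kernel h (omega K j)) * v t j
      + of_real (sine_kernel_primitive h (omega K j)) * f z j)" for j
    by (simp add: X_def)
  ultimately show ?thesis by (simp add: power2_eq_square mult_ac)
qed

text \<open>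
  This is a midpoint rule. Moving symmetrically away from the midpoint, the derivative of the
  error consists of a second difference of the nonlinearity, which is bounded at order \<open>s + 1\<close> and
  of size \<open>h\<^sup>2\<close> at order \<open>s - 1\<close>, and of terms with a factor \<open>cos - 1\<close>. Both are of size
  \<open>h powr (1 + \<alpha>)\<close> at order \<open>s - \<alpha>\<close>, the first by interpolation, the second as multipliers.
\<close>

lemma velocity_quadrature_error:
  assumes \<alpha>: "-1 \<le> \<alpha>" "\<alpha> \<le> 1"
  shows "N (s - \<alpha>) (\<lambda>j. v (t + h) j - (of_real (- omega K j * sin (h * omega K j)) * y t j
      + of_real (cos (h * omega K j)) * v t j + of_real h * f z j)) \<le> D * (h\<^sup>2 * h powr \<alpha>)"
proof -
  define V where "V \<tau> j = of_real (- omega K j * sin ((t + h - \<tau>) * omega K j)) * y \<tau> j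
      + of_real (cos ((t + h - \<tau>) * omega K j)) * v \<tau> j" for \<tau> j
  \<comment> \<open>The factors \<open>1\<close> and \<open>- 1\<close> match the form \<open>m + c * r\<close> of the chain rule for affine maps.\<close>
  define X where "X r j = V (m + 1 * r) j - V (m + (- 1) * r) j - of_real (2 * r) * f z j" for r j
  define \<phi> where "\<phi> r j = (f (y (m + r)) j + f (y (m - r)) j - 2 * f z j)
      + (of_real (cos ((h / 2 - r) * omega K j) - 1) * f (y (m + r)) j
       + of_real (cos ((h / 2 + r) * omega K j) - 1) * f (y (m - r)) j)" for r j
  have hp: "h * h powr \<alpha> = h powr (1 + \<alpha>)" using h_pos by (simp add: powr_add)
  have "N (s - \<alpha>) (\<lambda>j. X (h / 2) j - X 0 j) \<le> D * (h * h powr \<alpha>) * (h / 2 - 0)"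
  proof (rule norm_new_mean_value)
    fix r j assume r: "r \<in> {0..h / 2}" and j: "j \<in> I"
    have dV: "((\<lambda>\<tau>. V \<tau> j) has_vector_derivative of_real (cos ((t + h - \<tau>) * omega K j)) * f (y \<tau>) j)
        (at \<tau> within J)" if "\<tau> \<in> J" for \<tau>
      unfolding V_def by (rule flow_velocity_derivative[OF that j])
    have "((\<lambda>r. X r j) has_vector_derivative
        (1 *\<^sub>R (of_real (cos ((t + h - (m + 1 * r)) * omega K j)) * f (y (m + 1 * r)) j)
         - (- 1) *\<^sub>R (of_real (cos ((t + h - (m + (- 1) * r)) * omega K j)) * f (y (m + (- 1) * r)) j)
         - (of_real (2 * r) * 0 + of_real 2 * f z j))) (at r within {0..h / 2})"
      unfolding X_def
    proof (intro has_vector_derivative_diff has_vector_derivative_affine[where J = J] dV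
        has_vector_derivative_of_real_mult has_vector_derivative_const)
      show "((*) 2 has_real_derivative 2) (at r within {0..h / 2})"
        by (auto intro!: derivative_eq_intros)
    qed (use r t_in th_in in auto)
    then show "((\<lambda>r. X r j) has_vector_derivative \<phi> r j) (at r within {0..h / 2})"
      by (rule has_vector_derivative_eq_rhs) (simp add: \<phi>_def algebra_simps)
  next
    fix r assume r: "r \<in> {0..h / 2}"
    have i: "m + r \<in> {t..t + h}" "m - r \<in> {t..t + h}" using r by auto
    let ?\<Delta> = "\<lambda>j. f (y (m + r)) j + f (y (m - r)) j - 2 * f z j"
    have "N (s + 1 - (1 + \<alpha>)) ?\<Delta>
        \<le> h powr (1 + \<alpha>) * (N (s + 1) ?\<Delta> + N (s + 1 - 2) ?\<Delta> / h powr 2)"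
      using h_pos \<alpha> by (intro norm_new_interpolate) auto
    also have "\<dots> \<le> h powr (1 + \<alpha>) * (4 * G + G * (S + S\<^sup>2) * h\<^sup>2 / h powr 2)"
      using force_second_difference_stage[OF r] h_pos
      by (intro mult_left_mono add_mono divide_right_mono) auto
    also have "\<dots> = h powr (1 + \<alpha>) * (4 * G + G * (S + S\<^sup>2))" using h_pos by simp
    finally have 1: "N (s - \<alpha>) ?\<Delta> \<le> h powr (1 + \<alpha>) * (4 * G + G * (S + S\<^sup>2))" by simp
    have 2: "N (s - \<alpha>) (\<lambda>j. of_real (cos (a * omega K j) - 1) * f (y \<tau>) j) \<le> h powr (1 + \<alpha>) * (2 * G)"
      if "\<tau> \<in> {t..t + h}" "a \<in> {0..h}" for \<tau> a
    proof -
      have "N (s + 1 - (1 + \<alpha>)) (\<lambda>j. of_real (cos (a * omega K j) - 1) * f (y \<tau>) j)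
          \<le> 2 * h powr (1 + \<alpha>) * N (s + 1) (f (y \<tau>))"
        using that \<alpha> h_pos by (intro norm_new_multiplier abs_cos_minus_one_le_powr) auto
      also have "\<dots> \<le> 2 * h powr (1 + \<alpha>) * G"
        by (intro mult_left_mono force_le in_J that) auto
      finally show ?thesis by (simp add: mult_ac)
    qed
    have "N (s - \<alpha>) (\<phi> r) \<le> h powr (1 + \<alpha>) * (4 * G + G * (S + S\<^sup>2))
        + (h powr (1 + \<alpha>) * (2 * G) + h powr (1 + \<alpha>) * (2 * G))"
      unfolding \<phi>_def
      using r h_pos by (intro order_trans[OF norm_new_triangle] add_mono 1 2 i) auto
    also have "\<dots> = D * (h * h powr \<alpha>)"
      unfolding hp D_eq by (simp add: algebra_simps)
    finally show "N (s - \<alpha>) (\<phi> r) \<le> D * (h * h powr \<alpha>)" .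
  qed (use h_pos in simp)
  also have "D * (h * h powr \<alpha>) * (h / 2 - 0) = D * (h\<^sup>2 * h powr \<alpha>) / 2"
    by (simp add: power2_eq_square)
  also have "\<dots> \<le> D * (h\<^sup>2 * h powr \<alpha>)"
    using G_ge_1 R_ge_1 by (simp add: D_eq)
  finally have "N (s - \<alpha>) (\<lambda>j. X (h / 2) j - X 0 j) \<le> D * (h\<^sup>2 * h powr \<alpha>)" .
  moreover have "X (h / 2) j - X 0 j = v (t + h) j - (of_real (- omega K j * sin (h * omega K j)) * y t j
      + of_real (cos (h * omega K j)) * v t j + of_real h * f z j)" for j
    by (simp add: X_def V_def algebra_simps)
  ultimately show ?thesis by simp
qed

lemma position_defect:
  assumes \<alpha>: "-1 \<le> \<alpha>" "\<alpha> \<le> 1" and c: "0 \<le> c"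
    and b: "\<And>j. j \<in> I \<Longrightarrow> \<bar>(sinc (h * omega K j / 2))\<^sup>2 / 2 - b j\<bar> \<le> c * (h * w j) powr \<alpha>"
  shows "N (s + 1 - \<alpha>) (\<lambda>j. y (t + h) j - (of_real (cos (h * omega K j)) * y t j
      + of_real (h * sinc (h * omega K j)) * v t j + of_real (h\<^sup>2 * b j) * f z j))
    \<le> (D + c * G) * (h\<^sup>2 * h powr \<alpha>)"
proof -
  let ?q = "\<lambda>j. (sinc (h * omega K j / 2))\<^sup>2 / 2"
  define A where "A j = y (t + h) j - (of_real (cos (h * omega K j)) * y t j
      + of_real (sine_kernel h (omega K j)) * v t j
      + of_real (sine_kernel_primitive h (omega K j)) * f z j)" for j
  define B where "B j = of_real (?q j - b j) * f z j" for j
  have eq: "y (t + h) j - (of_real (cos (h * omega K j)) * y t j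
      + of_real (h * sinc (h * omega K j)) * v t j + of_real (h\<^sup>2 * b j) * f z j)
    = A j + of_real (h\<^sup>2) * B j" for j
    unfolding A_def B_def sine_kernel_def sine_kernel_primitive_def of_real_mult of_real_diff
    by (simp only: algebra_simps)
  have "N (s + 1 - \<alpha>) B \<le> c * h powr \<alpha> * N (s + 1) (f z)"
    unfolding B_def using c h_pos by (intro norm_new_multiplier b)
  also have "\<dots> \<le> c * h powr \<alpha> * G"
    using c norm_new_nonlin[OF stage_le' R_ge_1] by (intro mult_left_mono) auto
  finally have B: "h\<^sup>2 * N (s + 1 - \<alpha>) B \<le> h\<^sup>2 * (c * h powr \<alpha> * G)"
    by (intro mult_left_mono) auto
  have "N (s + 1 - \<alpha>) (\<lambda>j. A j + of_real (h\<^sup>2) * B j) \<le> N (s + 1 - \<alpha>) A + h\<^sup>2 * N (s + 1 - \<alpha>) B"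
    using norm_new_triangle[of _ A "\<lambda>j. of_real (h\<^sup>2) * B j"] norm_new_scale[of _ "h\<^sup>2" B] by simp
  also have "\<dots> \<le> D * (h\<^sup>2 * h powr \<alpha>) + h\<^sup>2 * (c * h powr \<alpha> * G)"
    using position_quadrature_error[OF \<alpha>] B by (intro add_mono) (simp_all add: A_def[abs_def])
  also have "\<dots> = (D + c * G) * (h\<^sup>2 * h powr \<alpha>)" by (simp add: algebra_simps)
  finally show ?thesis unfolding eq .
qed

lemma velocity_defect:
  assumes \<alpha>: "-1 \<le> \<alpha>" "\<alpha> \<le> 1" and c: "0 \<le> c"
    and b: "\<And>j. j \<in> I \<Longrightarrow> \<bar>1 - b j\<bar> \<le> c * (h * w j) powr (1 + \<alpha>)"
  shows "N (s - \<alpha>) (\<lambda>j. v (t + h) j - (of_real (- (omega K j * sin (h * omega K j))) * y t j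
      + of_real (cos (h * omega K j)) * v t j + of_real (h * b j) * f z j))
    \<le> (D + c * G) * (h\<^sup>2 * h powr \<alpha>)"
proof -
  define A where "A j = v (t + h) j - (of_real (- omega K j * sin (h * omega K j)) * y t j
      + of_real (cos (h * omega K j)) * v t j + of_real h * f z j)" for j
  define B where "B j = of_real (1 - b j) * f z j" for j
  have eq: "v (t + h) j - (of_real (- (omega K j * sin (h * omega K j))) * y t j
      + of_real (cos (h * omega K j)) * v t j + of_real (h * b j) * f z j)
    = A j + of_real h * B j" for j
    unfolding A_def B_def by (simp add: algebra_simps)
  have "N (s + 1 - (1 + \<alpha>)) B \<le> c * h powr (1 + \<alpha>) * N (s + 1) (f z)"
    unfolding B_def using c h_pos by (intro norm_new_multiplier b)
  also have "\<dots> \<le> c * h powr (1 + \<alpha>) * G"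
    using c norm_new_nonlin[OF stage_le' R_ge_1] by (intro mult_left_mono) auto
  finally have B: "h * N (s - \<alpha>) B \<le> h * (c * h powr (1 + \<alpha>) * G)"
    using h_pos by (intro mult_left_mono) auto
  have "N (s - \<alpha>) (\<lambda>j. A j + of_real h * B j) \<le> N (s - \<alpha>) A + h * N (s - \<alpha>) B"
    using norm_new_triangle[of _ A "\<lambda>j. of_real h * B j"] norm_new_scale[of _ h B] h_pos by simp
  also have "\<dots> \<le> D * (h\<^sup>2 * h powr \<alpha>) + h * (c * h powr (1 + \<alpha>) * G)"
    using velocity_quadrature_error[OF \<alpha>] B by (intro add_mono) (simp_all add: A_def[abs_def])
  also have "\<dots> = (D + c * G) * (h\<^sup>2 * h powr \<alpha>)"
    using h_pos by (simp add: algebra_simps powr_add power2_eq_square)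
  finally show ?thesis unfolding eq .
qed

end

section \<open>Energy norm and stability\<close>

text \<open>
  Position and velocity are combined by a sum of squares because at each nonzero frequency the linear
  flow rotates the pair of the weighted position and the velocity.
\<close>

definition energy_norm :: "nat \<Rightarrow> real \<Rightarrow> (int \<Rightarrow> complex) \<Rightarrow> (int \<Rightarrow> complex) \<Rightarrow> real" where
  "energy_norm K a y v = sqrt ((norm_new K (a + 1) y)\<^sup>2 + (norm_new K a v)\<^sup>2)"

lemma cmod_rotation:
  "(cmod (of_real (cos a) * x + of_real (sin a) * u))\<^sup>2
    + (cmod (- of_real (sin a) * x + of_real (cos a) * u))\<^sup>2 = (cmod x)\<^sup>2 + (cmod u)\<^sup>2"
proof -
  have r: "(cos a * b + sin a * d)\<^sup>2 + (cos a * d - sin a * b)\<^sup>2 = b\<^sup>2 + d\<^sup>2" for b d :: real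
    using sin_cos_squared_add[of a] by algebra
  show ?thesis
    using r[of "Re x" "Re u"] r[of "Im x" "Im u"] by (simp add: cmod_power2 algebra_simps)
qed

context grid
begin

abbreviation "E \<equiv> energy_norm K"

lemma energy_norm_nonneg [simp]: "0 \<le> E a y v"
  by (simp add: energy_norm_def)

lemma norm_new_le_energy_norm: "N (a + 1) y \<le> E a y v" "N a v \<le> E a y v"
  unfolding energy_norm_def
  by (rule real_sqrt_sum_squares_ge1 real_sqrt_sum_squares_ge2)+

lemma energy_norm_le_add: "E a y v \<le> N (a + 1) y + N a v"
  unfolding energy_norm_def by (rule sqrt_sum_squares_le_sum) auto

lemma energy_norm_triangle:
  "E a (\<lambda>j. y j + y' j) (\<lambda>j. v j + v' j) \<le> E a y v + E a y' v'"
proof -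
  have "E a (\<lambda>j. y j + y' j) (\<lambda>j. v j + v' j)
      \<le> sqrt ((N (a + 1) y + N (a + 1) y')\<^sup>2 + (N a v + N a v')\<^sup>2)"
    unfolding energy_norm_def
    by (intro real_sqrt_le_mono add_mono power_mono norm_new_triangle) auto
  also have "\<dots> \<le> E a y v + E a y' v'"
    unfolding energy_norm_def by (rule real_sqrt_sum_squares_triangle_ineq)
  finally show ?thesis .
qed

lemma energy_norm_squared:
  "(E a y v)\<^sup>2 = (\<Sum>j\<in>I. w j powr (2 * a) * ((w j * cmod (y j))\<^sup>2 + (cmod (v j))\<^sup>2))"
proof -
  have sq: "(N \<sigma> x)\<^sup>2 = (\<Sum>j\<in>I. w j powr (2 * \<sigma>) * (cmod (x j))\<^sup>2)" for \<sigma> x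
    unfolding norm_new_def weight_def[symmetric] by (rule real_sqrt_pow2) (auto intro!: sum_nonneg)
  have "w j powr (2 * (a + 1)) = w j powr (2 * a) * (w j)\<^sup>2" for j
    by (simp add: distrib_left powr_add)
  have "(E a y v)\<^sup>2 = (N (a + 1) y)\<^sup>2 + (N a v)\<^sup>2"
    by (simp add: energy_norm_def)
  also have "\<dots> = (\<Sum>j\<in>I. w j powr (2 * a) * ((w j * cmod (y j))\<^sup>2 + (cmod (v j))\<^sup>2))"
    using \<open>\<And>j. w j powr (2 * (a + 1)) = w j powr (2 * a) * (w j)\<^sup>2\<close>
    unfolding sq by (simp add: sum.distrib[symmetric] power_mult_distrib distrib_left mult.assoc)
  finally show ?thesis .
qed

text \<open>
  At a nonzero frequency the flow is an isometry; the factor \<open>1 + h\<close> comes from the shear at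
  frequency \<open>0\<close>.
\<close>

lemma energy_norm_flow:
  assumes "0 \<le> h"
  shows "E a (\<lambda>j. of_real (cos (h * omega K j)) * y j + of_real (h * sinc (h * omega K j)) * v j)
      (\<lambda>j. of_real (- (omega K j * sin (h * omega K j))) * y j + of_real (cos (h * omega K j)) * v j)
    \<le> (1 + h) * E a y v"
    (is "E a ?y ?v \<le> _")
proof (rule power2_le_imp_le)
  have pt: "(w j * cmod (?y j))\<^sup>2 + (cmod (?v j))\<^sup>2 \<le> (1 + h)\<^sup>2 * ((w j * cmod (y j))\<^sup>2 + (cmod (v j))\<^sup>2)"
    if j: "j \<in> I" for j
  proof (cases "j = 0")
    case True
    have w0: "w j \<le> 1" using True omega_min_bounds by (simp add: weight_0)
    define A B where "A = w j * cmod (y j)" and "B = cmod (v j)"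
    have AB: "0 \<le> A" "0 \<le> B" by (auto simp: A_def B_def)
    have "w j * cmod (?y j) \<le> w j * (cmod (y j) + h * B)"
      using True assms norm_triangle_ineq[of "y j" "of_real h * v j"]
      by (intro mult_left_mono) (auto simp: B_def norm_mult)
    also have "\<dots> \<le> A + h * B"
      using w0 AB assms mult_right_mono[OF w0, of "h * B"] by (simp add: A_def distrib_left)
    finally have "(w j * cmod (?y j))\<^sup>2 \<le> (A + h * B)\<^sup>2" by (intro power_mono) auto
    moreover have "cmod (?v j) = B" using True by (simp add: B_def)
    moreover have "(A + h * B)\<^sup>2 + B\<^sup>2 \<le> (1 + h)\<^sup>2 * (A\<^sup>2 + B\<^sup>2)"
    proof -
      have "(1 + h)\<^sup>2 * (A\<^sup>2 + B\<^sup>2) - ((A + h * B)\<^sup>2 + B\<^sup>2)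
          = h * (A - B)\<^sup>2 + h * (A\<^sup>2 + B\<^sup>2) + h\<^sup>2 * A\<^sup>2"
        by (simp add: power2_eq_square algebra_simps)
      also have "\<dots> \<ge> 0" using assms by simp
      finally show ?thesis by simp
    qed
    ultimately show ?thesis by (simp add: A_def B_def)
  next
    case False
    define p where "p = omega K j"
    have p: "w j = p" "p > 0" using weight_nonzero[OF j False] weight_pos[of j] by (auto simp: p_def)
    have "w j * cmod (?y j) = cmod (of_real p * ?y j)" using p by (simp add: norm_mult)
    also have "of_real p * ?y j = of_real (cos (h * p)) * (of_real p * y j) + of_real (sin (h * p)) * v j"
      using p assms by (simp add: p_def[symmetric] field_simps)
    finally have 1: "w j * cmod (?y j)
      = cmod (of_real (cos (h * p)) * (of_real p * y j) + of_real (sin (h * p)) * v j)" .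
    have 2: "?v j = - of_real (sin (h * p)) * (of_real p * y j) + of_real (cos (h * p)) * v j"
      by (simp add: p_def[symmetric])
    have "(w j * cmod (?y j))\<^sup>2 + (cmod (?v j))\<^sup>2 = 1 * ((w j * cmod (y j))\<^sup>2 + (cmod (v j))\<^sup>2)"
      unfolding 1 2 cmod_rotation using p by (simp add: norm_mult)
    also have "\<dots> \<le> (1 + h)\<^sup>2 * ((w j * cmod (y j))\<^sup>2 + (cmod (v j))\<^sup>2)"
      using assms by (intro mult_right_mono one_le_power) auto
    finally show ?thesis .
  qed
  have "(E a ?y ?v)\<^sup>2 \<le> (\<Sum>j\<in>I. w j powr (2 * a) * ((1 + h)\<^sup>2 * ((w j * cmod (y j))\<^sup>2 + (cmod (v j))\<^sup>2)))"
    unfolding energy_norm_squared by (intro sum_mono mult_left_mono pt) auto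
  also have "\<dots> = ((1 + h) * E a y v)\<^sup>2"
    unfolding power_mult_distrib energy_norm_squared sum_distrib_left
    by (rule sum.cong) (simp_all only: mult_ac)
  finally show "(E a ?y ?v)\<^sup>2 \<le> ((1 + h) * E a y v)\<^sup>2" .
qed (use assms in simp)

lemma erkn_half_diff:
  "erkn_half K h y v j - erkn_half K h y' v' j
    = erkn_half K h (\<lambda>j. y j - y' j) (\<lambda>j. v j - v' j) j"
  by (simp add: erkn_half_eq algebra_simps)

end

text \<open>
  The form in which the hypotheses on the coefficients are used: with the weight in place of the
  frequency they cover the frequency \<open>0\<close> as well. The exponent \<open>\<alpha>\<close> serves for the local error, the
  exponent \<open>min \<alpha> 0\<close> for stability.
\<close>

definition mode_coefficients_bounded ::
  "nat \<Rightarrow> real \<Rightarrow> real \<Rightarrow> real \<Rightarrow> (int \<Rightarrow> real) \<Rightarrow> (int \<Rightarrow> real) \<Rightarrow> bool" where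
  "mode_coefficients_bounded K h c \<alpha> B b \<longleftrightarrow> (\<forall>j\<in>modes K.
     \<bar>(sinc (h * omega K j / 2))\<^sup>2 / 2 - B j\<bar> \<le> c * (h * weight K j) powr \<alpha> \<and>
     \<bar>B j\<bar> \<le> c * (h * weight K j) powr min \<alpha> 0 \<and>
     \<bar>1 - b j\<bar> \<le> c * (h * weight K j) powr (1 + \<alpha>) \<and>
     \<bar>1 - b j\<bar> \<le> c * (h * weight K j) powr (1 + min \<alpha> 0))"

context grid
begin

text \<open>
  For \<open>\<alpha> \<le> 0\<close> the comparison with \<open>sinc\<^sup>2 / 2\<close> is not part of the hypothesis, but it holds since
  both functions are bounded by multiples of \<open>x powr \<alpha>\<close>; this costs the \<open>1\<close> in \<open>c + 1\<close>.
\<close>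

lemma mode_coefficients_bounded_of_condition_A:
  assumes h: "0 < h" "h \<le> 1" and \<alpha>: "-1 \<le> \<alpha>" "\<alpha> \<le> 1" and c: "1 \<le> c"
    and A0: "condition_A K h c 0 bbar1 b1" and A\<alpha>: "condition_A K h c \<alpha> bbar1 b1"
    and Z: "zero_frequency_limit c \<alpha> bbar1 b1"
  shows "mode_coefficients_bounded K h (c + 1) \<alpha>
    (\<lambda>j. bbar1 (h\<^sup>2 * (omega K j)\<^sup>2)) (\<lambda>j. b1 (h\<^sup>2 * (omega K j)\<^sup>2))"
  unfolding mode_coefficients_bounded_def
proof (intro ballI)
  fix j assume j: "j \<in> I"
  let ?x = "h * w j"
  let ?q = "(sinc (h * omega K j / 2))\<^sup>2 / 2"
  let ?B = "bbar1 (h\<^sup>2 * (omega K j)\<^sup>2)" and ?b = "b1 (h\<^sup>2 * (omega K j)\<^sup>2)"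
  have x: "0 < ?x" using h by simp
  have B: "\<bar>?B\<bar> \<le> c * ?x powr min \<alpha> 0"
  proof (cases "j = 0")
    case True
    have "?x \<le> 1 * 1" using True h omega_min_bounds by (intro mult_mono) (auto simp: weight_0)
    then have "?x powr 0 \<le> ?x powr min \<alpha> 0" using x by (intro powr_mono') auto
    then have "c * 1 \<le> c * ?x powr min \<alpha> 0" using c h x by (intro mult_left_mono) auto
    then show ?thesis using Z True by (simp add: zero_frequency_limit_def)
  next
    case False
    then show ?thesis
      using A0 A\<alpha> j \<alpha> h weight_nonzero[OF j False] weight_neq_0[of j]
      by (cases "0 < \<alpha>") (auto simp: condition_A_def Let_def power_mult_distrib min_def)
  qed
  have b: "\<bar>1 - ?b\<bar> \<le> c * ?x powr (1 + \<alpha>)" "\<bar>1 - ?b\<bar> \<le> c * ?x powr (1 + min \<alpha> 0)"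
  proof -
    have "\<bar>1 - ?b\<bar> \<le> c * ?x powr (1 + \<alpha>) \<and> \<bar>1 - ?b\<bar> \<le> c * ?x powr (1 + 0)"
    proof (cases "j = 0")
      case True
      then show ?thesis using Z c x by (simp add: zero_frequency_limit_def)
    next
      case False
      then show ?thesis
        using A0 A\<alpha> j \<alpha> h weight_nonzero[OF j False] weight_neq_0[of j]
        by (auto simp: condition_A_def Let_def power_mult_distrib)
    qed
    then show "\<bar>1 - ?b\<bar> \<le> c * ?x powr (1 + \<alpha>)" "\<bar>1 - ?b\<bar> \<le> c * ?x powr (1 + min \<alpha> 0)"
      by (auto simp: min_def)
  qed
  have q: "\<bar>?q - ?B\<bar> \<le> (c + 1) * ?x powr \<alpha>"
  proof (cases "0 < \<alpha>")
    case True
    have "\<bar>?q - ?B\<bar> \<le> c * ?x powr \<alpha>"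
    proof (cases "j = 0")
      case True
      have "bbar1 0 = 1 / 2" using Z \<open>0 < \<alpha>\<close> by (simp add: zero_frequency_limit_def)
      then have "\<bar>?q - ?B\<bar> = 0" using True by (simp del: eq_divide_eq_numeral1)
      then show ?thesis using c by simp
    next
      case False
      then show ?thesis
        using A\<alpha> j \<alpha> True h weight_nonzero[OF j False] weight_neq_0[of j]
        by (auto simp: condition_A_def Let_def power_mult_distrib)
    qed
    also have "\<dots> \<le> (c + 1) * ?x powr \<alpha>" by (intro mult_right_mono) auto
    finally show ?thesis .
  next
    case False
    have "\<bar>?q\<bar> \<le> ?x powr \<alpha>" using j h \<alpha> False by (intro half_sinc_squared_le_powr) auto
    moreover have "\<bar>?B\<bar> \<le> c * ?x powr \<alpha>" using B False by (simp add: min_def)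
    moreover have "(c + 1) * ?x powr \<alpha> = c * ?x powr \<alpha> + ?x powr \<alpha>" by (simp only: distrib_right mult_1)
    ultimately show ?thesis
      using abs_triangle_ineq4[of ?q ?B] by linarith
  qed
  have weaken: "u \<le> (c + 1) * r" if "u \<le> c * r" "0 \<le> r" for u r :: real
    using that by (simp add: distrib_right)
  show "\<bar>?q - ?B\<bar> \<le> (c + 1) * ?x powr \<alpha> \<and> \<bar>?B\<bar> \<le> (c + 1) * ?x powr min \<alpha> 0
      \<and> \<bar>1 - ?b\<bar> \<le> (c + 1) * ?x powr (1 + \<alpha>) \<and> \<bar>1 - ?b\<bar> \<le> (c + 1) * ?x powr (1 + min \<alpha> 0)"
    using q weaken[OF B] weaken[OF b(1)] weaken[OF b(2)] by simp
qed

end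

context smooth_grid
begin

text \<open>
  The nonlinearity is Lipschitz continuous at order \<open>\<tau> = s + 1 - max \<alpha> 0\<close>, the largest order that
  both the error and the regularity \<open>s + 1\<close> of the two stages permit. From \<open>\<tau>\<close> the orders
  \<open>s + 1 - \<alpha>\<close> and \<open>s - \<alpha>\<close> are reached through the coefficients, which satisfy the multiplier
  bounds with exponents \<open>min \<alpha> 0\<close> and \<open>1 + min \<alpha> 0\<close>; the powers of \<open>h\<close> lost there are covered by
  the factors \<open>h\<^sup>2\<close> and \<open>h\<close> of the scheme.
\<close>

lemma force_difference_energy_norm:
  fixes p :: nat
  assumes h: "0 < h" "h \<le> 1" and \<alpha>: "-1 \<le> \<alpha>" "\<alpha> \<le> 1" and R: "1 \<le> R" and c: "0 \<le> c"
    and coeffs: "mode_coefficients_bounded K h c \<alpha> B b"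
    and z: "N (s + 1) (erkn_half K h y v) \<le> R" and z': "N (s + 1) (erkn_half K h y' v') \<le> R"
  defines "\<Delta> \<equiv> \<lambda>j. nonlin K p (erkn_half K h y v) j - nonlin K p (erkn_half K h y' v') j"
  shows "E (s - \<alpha>) (\<lambda>j. of_real (h\<^sup>2 * B j) * \<Delta> j) (\<lambda>j. of_real (h * b j) * \<Delta> j)
    \<le> h * (8 * (c + 1) * nonlin_const s p R) * E (s - \<alpha>) (\<lambda>j. y j - y' j) (\<lambda>j. v j - v' j)"
proof -
  let ?e = "\<lambda>j. y j - y' j" and ?e' = "\<lambda>j. v j - v' j"
  define \<beta> where "\<beta> = min \<alpha> 0"
  define \<tau> where "\<tau> = s + 1 - max \<alpha> 0"
  define G where "G = nonlin_const s p R"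
  define X where "X = E (s - \<alpha>) ?e ?e'"
  have \<beta>: "-1 \<le> \<beta>" "\<beta> \<le> 0" "\<tau> - \<beta> = s + 1 - \<alpha>" using \<alpha> by (auto simp: \<beta>_def \<tau>_def)
  have G: "1 \<le> G" unfolding G_def by (rule nonlin_const_bounds(1)[OF R])
  have two: "2 powr r \<le> (2::real)" if "r \<le> 1" for r
    using powr_mono[OF that, of "2::real"] by simp
  have half: "N \<tau> (\<lambda>j. erkn_half K h y v j - erkn_half K h y' v' j) \<le> 4 * X"
  proof -
    have "N \<tau> (\<lambda>j. erkn_half K h y v j - erkn_half K h y' v' j) \<le> N \<tau> ?e + N (\<tau> - 1) ?e'"
      using norm_new_erkn_half[of h "\<tau> - 1" ?e ?e'] h by (simp add: erkn_half_diff[abs_def])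
    also have "N \<tau> ?e \<le> 2 powr (s - \<alpha> + 1 - \<tau>) * N (s - \<alpha> + 1) ?e"
      using \<beta> by (intro norm_new_lower_order) linarith
    also have "\<dots> \<le> 2 * X"
      unfolding X_def using \<beta> by (intro mult_mono two norm_new_le_energy_norm) auto
    also have "N (\<tau> - 1) ?e' \<le> 2 powr (s - \<alpha> - (\<tau> - 1)) * N (s - \<alpha>) ?e'"
      using \<beta> by (intro norm_new_lower_order) linarith
    also have "\<dots> \<le> 2 * X"
      unfolding X_def using \<beta> by (intro mult_mono two norm_new_le_energy_norm) auto
    finally show ?thesis by simp
  qed
  have "N \<tau> \<Delta> \<le> G * N \<tau> (\<lambda>j. erkn_half K h y v j - erkn_half K h y' v' j)"
    unfolding \<Delta>_def G_def using \<alpha> s_nonneg by (intro norm_new_nonlin_diff z z' R) (auto simp: \<tau>_def max_def)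
  also have "\<dots> \<le> G * (4 * X)" using half G by (intro mult_left_mono) auto
  finally have \<Delta>: "N \<tau> \<Delta> \<le> 4 * G * X" by simp
  have h\<beta>: "h * h powr \<beta> \<le> 1" "h powr (1 + \<beta>) \<le> 1"
  proof -
    show "h powr (1 + \<beta>) \<le> 1" using h \<beta> powr_mono'[of 0 "1 + \<beta>" h] by simp
    then show "h * h powr \<beta> \<le> 1" using h by (simp add: powr_add)
  qed
  have pos: "N (s - \<alpha> + 1) (\<lambda>j. of_real (h\<^sup>2 * B j) * \<Delta> j) \<le> h * (c * N \<tau> \<Delta>)"
  proof -
    have sa: "s - \<alpha> + 1 = \<tau> - \<beta>" using \<beta> by linarith
    have "N (s - \<alpha> + 1) (\<lambda>j. of_real (h\<^sup>2) * (of_real (B j) * \<Delta> j)) = h\<^sup>2 * N (\<tau> - \<beta>) (\<lambda>j. of_real (B j) * \<Delta> j)"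
      unfolding norm_new_scale sa by simp
    also have "\<dots> \<le> h\<^sup>2 * (c * h powr \<beta> * N \<tau> \<Delta>)"
      using coeffs c h unfolding mode_coefficients_bounded_def \<beta>_def[symmetric]
      by (intro mult_left_mono norm_new_multiplier) auto
    also have "\<dots> = (h * h powr \<beta>) * (h * (c * N \<tau> \<Delta>))" by (simp add: power2_eq_square mult_ac)
    also have "\<dots> \<le> 1 * (h * (c * N \<tau> \<Delta>))"
      using h c by (intro mult_right_mono h\<beta>) auto
    finally show ?thesis by (simp add: mult.assoc)
  qed
  have vel: "N (s - \<alpha>) (\<lambda>j. of_real (h * b j) * \<Delta> j) \<le> h * ((2 + c) * N \<tau> \<Delta>)"
  proof -
    have "N (s - \<alpha>) \<Delta> \<le> 2 powr (\<tau> - (s - \<alpha>)) * N \<tau> \<Delta>"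
      using \<beta> by (intro norm_new_lower_order) linarith
    also have "\<dots> \<le> 2 * N \<tau> \<Delta>" using \<beta> by (intro mult_right_mono two) auto
    finally have 1: "N (s - \<alpha>) \<Delta> \<le> 2 * N \<tau> \<Delta>" .
    have "N (\<tau> - (1 + \<beta>)) (\<lambda>j. of_real (1 - b j) * \<Delta> j) \<le> c * h powr (1 + \<beta>) * N \<tau> \<Delta>"
      using coeffs c h unfolding mode_coefficients_bounded_def \<beta>_def[symmetric]
      by (intro norm_new_multiplier) auto
    also have "\<dots> \<le> c * 1 * N \<tau> \<Delta>"
      using c h\<beta> by (intro mult_right_mono mult_left_mono) auto
    finally have 2: "N (\<tau> - (1 + \<beta>)) (\<lambda>j. of_real (1 - b j) * \<Delta> j) \<le> c * N \<tau> \<Delta>" by simp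
    have "\<tau> - (1 + \<beta>) = s - \<alpha>" using \<beta> by linarith
    note 2 = 2[unfolded this]
    have "N (s - \<alpha>) (\<lambda>j. of_real (h * b j) * \<Delta> j)
        = N (s - \<alpha>) (\<lambda>j. of_real h * (\<Delta> j - of_real (1 - b j) * \<Delta> j))"
      by (simp add: algebra_simps)
    also have "\<dots> = h * N (s - \<alpha>) (\<lambda>j. \<Delta> j - of_real (1 - b j) * \<Delta> j)"
      using h by (simp only: norm_new_scale abs_of_pos)
    also have "\<dots> \<le> h * (2 * N \<tau> \<Delta> + c * N \<tau> \<Delta>)"
      using h by (intro mult_left_mono order_trans[OF norm_new_diff_triangle add_mono[OF 1 2]]) auto
    finally show ?thesis by (simp add: distrib_right)
  qed
  have "E (s - \<alpha>) (\<lambda>j. of_real (h\<^sup>2 * B j) * \<Delta> j) (\<lambda>j. of_real (h * b j) * \<Delta> j)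
      \<le> h * (c * N \<tau> \<Delta>) + h * ((2 + c) * N \<tau> \<Delta>)"
    using energy_norm_le_add add_mono[OF pos vel] by (rule order_trans)
  also have "\<dots> = h * (2 * (c + 1)) * N \<tau> \<Delta>" by (simp add: algebra_simps)
  also have "\<dots> \<le> h * (2 * (c + 1)) * (4 * G * X)"
    using h c by (intro mult_left_mono \<Delta>) auto
  also have "\<dots> = h * (8 * (c + 1) * G) * X" by simp
  finally show ?thesis by (simp only: G_def X_def)
qed

end

definition growth_const :: "real \<Rightarrow> nat \<Rightarrow> real \<Rightarrow> real \<Rightarrow> real" where
  "growth_const s p R c = 1 + 8 * (c + 1) * nonlin_const s p R"

definition local_error_const :: "real \<Rightarrow> nat \<Rightarrow> real \<Rightarrow> real \<Rightarrow> real" where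
  "local_error_const s p R c = 2 * (defect_const s p R + c * nonlin_const s p R)"

context regular_step
begin

lemma stage_le_of_small_error:
  assumes "E s (\<lambda>j. y t j - y' j) (\<lambda>j. v t j - v' j) \<le> 1 / 2"
  shows "N (s + 1) (erkn_half K h y' v') \<le> R"
proof -
  let ?e = "\<lambda>j. y t j - y' j" and ?e' = "\<lambda>j. v t j - v' j"
  have "erkn_half K h y' v' j = z j - erkn_half K h ?e ?e' j" for j
    by (simp only: erkn_half_diff[of h "y t" "v t" j y' v', symmetric]) simp
  then have "N (s + 1) (erkn_half K h y' v') = N (s + 1) (\<lambda>j. z j - erkn_half K h ?e ?e' j)" by metis
  also have "\<dots> \<le> N (s + 1) z + N (s + 1) (erkn_half K h ?e ?e')" by (rule norm_new_diff_triangle)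
  also have "\<dots> \<le> (R - 1) + (N (s + 1) ?e + N s ?e')"
    using h_pos h_le_1 by (intro add_mono stage_le norm_new_erkn_half) auto
  also have "\<dots> \<le> R"
    using assms norm_new_le_energy_norm(1)[of s ?e ?e'] norm_new_le_energy_norm(2)[of s ?e' ?e] by linarith
  finally show ?thesis .
qed

lemma one_step_error:
  assumes \<alpha>: "-1 \<le> \<alpha>" "\<alpha> \<le> 1" and c: "0 \<le> c"
    and coeffs: "mode_coefficients_bounded K h c \<alpha>
      (\<lambda>j. bbar1 (h\<^sup>2 * (omega K j)\<^sup>2)) (\<lambda>j. b1 (h\<^sup>2 * (omega K j)\<^sup>2))"
    and stage: "N (s + 1) (erkn_half K h y' v') \<le> R"
  shows "E (s - \<alpha>) (\<lambda>j. y (t + h) j - fst (erkn_step K p bbar1 b1 h (y', v')) j)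
      (\<lambda>j. v (t + h) j - snd (erkn_step K p bbar1 b1 h (y', v')) j)
    \<le> (1 + growth_const s p R c * h) * E (s - \<alpha>) (\<lambda>j. y t j - y' j) (\<lambda>j. v t j - v' j)
      + h * (local_error_const s p R c * h powr (1 + \<alpha>))"
proof -
  let ?e = "\<lambda>j. y t j - y' j" and ?e' = "\<lambda>j. v t j - v' j"
  define B where "B j = bbar1 (h\<^sup>2 * (omega K j)\<^sup>2)" for j
  define b where "b j = b1 (h\<^sup>2 * (omega K j)\<^sup>2)" for j
  have co: "mode_coefficients_bounded K h c \<alpha> B b"
    using coeffs by (simp only: B_def[abs_def] b_def[abs_def])
  define z' where "z' = erkn_half K h y' v'"
  define \<Delta> where "\<Delta> j = f z j - f z' j" for j
  define d1 where "d1 j = y (t + h) j - (of_real (cos (h * omega K j)) * y t j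
      + of_real (h * sinc (h * omega K j)) * v t j + of_real (h\<^sup>2 * B j) * f z j)" for j
  define d2 where "d2 j = v (t + h) j - (of_real (- (omega K j * sin (h * omega K j))) * y t j
      + of_real (cos (h * omega K j)) * v t j + of_real (h * b j) * f z j)" for j
  define l1 where "l1 j = of_real (cos (h * omega K j)) * ?e j + of_real (h * sinc (h * omega K j)) * ?e' j" for j
  define l2 where "l2 j = of_real (- (omega K j * sin (h * omega K j))) * ?e j + of_real (cos (h * omega K j)) * ?e' j" for j
  define n1 where "n1 j = of_real (h\<^sup>2 * B j) * \<Delta> j" for j
  define n2 where "n2 j = of_real (h * b j) * \<Delta> j" for j
  have s1: "fst (erkn_step K p bbar1 b1 h (y', v')) j = of_real (cos (h * omega K j)) * y' j
      + of_real (h * sinc (h * omega K j)) * v' j + of_real (h\<^sup>2 * B j) * f z' j" for j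
    unfolding erkn_step_def Let_def prod.case fst_conv B_def z'_def ..
  have s2: "snd (erkn_step K p bbar1 b1 h (y', v')) j = - of_real (omega K j * sin (h * omega K j)) * y' j
      + of_real (cos (h * omega K j)) * v' j + of_real (h * b j) * f z' j" for j
    unfolding erkn_step_def Let_def prod.case snd_conv b_def z'_def ..
  have 1: "y (t + h) j - fst (erkn_step K p bbar1 b1 h (y', v')) j = d1 j + (l1 j + n1 j)" for j
    unfolding s1 d1_def l1_def n1_def \<Delta>_def by (simp only: algebra_simps)
  have 2: "v (t + h) j - snd (erkn_step K p bbar1 b1 h (y', v')) j = d2 j + (l2 j + n2 j)" for j
    unfolding s2 d2_def l2_def n2_def \<Delta>_def by (simp only: of_real_minus algebra_simps)
  have "E (s - \<alpha>) (\<lambda>j. d1 j + (l1 j + n1 j)) (\<lambda>j. d2 j + (l2 j + n2 j))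
      \<le> E (s - \<alpha>) d1 d2 + (E (s - \<alpha>) l1 l2 + E (s - \<alpha>) n1 n2)"
    by (rule order_trans[OF energy_norm_triangle add_left_mono[OF energy_norm_triangle]])
  also have "E (s - \<alpha>) d1 d2 \<le> h * (local_error_const s p R c * h powr (1 + \<alpha>))"
  proof -
    have p1: "N (s - \<alpha> + 1) d1 \<le> (D + c * G) * (h\<^sup>2 * h powr \<alpha>)"
      using position_defect[OF \<alpha> c, of B] co
      by (simp add: mode_coefficients_bounded_def d1_def[abs_def] algebra_simps)
    have p2: "N (s - \<alpha>) d2 \<le> (D + c * G) * (h\<^sup>2 * h powr \<alpha>)"
      using velocity_defect[OF \<alpha> c, of b] co
      by (simp add: mode_coefficients_bounded_def d2_def[abs_def])
    have hp: "h\<^sup>2 * h powr \<alpha> = h * h powr (1 + \<alpha>)"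
      using h_pos by (simp add: powr_add power2_eq_square)
    have "E (s - \<alpha>) d1 d2 \<le> (D + c * G) * (h * h powr (1 + \<alpha>)) + (D + c * G) * (h * h powr (1 + \<alpha>))"
      using order_trans[OF energy_norm_le_add add_mono[OF p1 p2]] unfolding hp .
    then show ?thesis by (simp only: local_error_const_def mult_ac mult_2 distrib_left distrib_right)
  qed
  also have "E (s - \<alpha>) l1 l2 \<le> (1 + h) * E (s - \<alpha>) ?e ?e'"
    unfolding l1_def[abs_def] l2_def[abs_def] using h_pos by (intro energy_norm_flow) simp
  also have "E (s - \<alpha>) n1 n2 \<le> h * (8 * (c + 1) * G) * E (s - \<alpha>) ?e ?e'"
    unfolding n1_def[abs_def] n2_def[abs_def] \<Delta>_def[abs_def] z'_def
    by (rule force_difference_energy_norm[OF h_pos h_le_1 \<alpha> R_ge_1 c co stage_le' stage])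
  finally show ?thesis
    unfolding 1 2 growth_const_def by (simp add: algebra_simps)
qed

end

section \<open>Global error\<close>

text \<open>
  The recursion is only demanded while the asserted bound holds, so that the lemma can be used
  for a bootstrap argument.
\<close>

lemma discrete_gronwall:
  fixes e :: "nat \<Rightarrow> real"
  assumes h: "0 < h" and L: "0 \<le> L" and d: "0 \<le> d" and e0: "e 0 \<le> 0"
    and step: "\<And>n. real (Suc n) * h \<le> T \<Longrightarrow> e n \<le> T * d * exp (L * T) \<Longrightarrow>
      e (Suc n) \<le> (1 + L * h) * e n + h * d"
    and n: "real n * h \<le> T"
  shows "e n \<le> T * d * exp (L * T)"
proof -
  let ?a = "1 + L * h"
  have a: "1 \<le> ?a" using h L by simp
  have bound: "real n * h * d * ?a ^ n \<le> T * d * exp (L * T)" if "real n * h \<le> T" for n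
  proof -
    have "?a ^ n \<le> exp (L * h) ^ n" using a by (intro power_mono) (auto simp: exp_ge_add_one_self)
    also have "\<dots> = exp (L * (real n * h))" by (simp add: exp_of_nat_mult[symmetric] mult_ac)
    also have "\<dots> \<le> exp (L * T)" using that L by (simp add: mult_left_mono)
    finally have "?a ^ n \<le> exp (L * T)" .
    moreover have "0 \<le> T" using order_trans[OF _ that] h by simp
    ultimately show ?thesis using that d h a by (intro mult_mono) auto
  qed
  have "e n \<le> real n * h * d * ?a ^ n"
    using n
  proof (induction n)
    case 0
    then show ?case using e0 by simp
  next
    case (Suc n)
    then have nT: "real n * h \<le> T" using h by (simp add: distrib_right)
    note IH = Suc.IH[OF nT]
    have "e (Suc n) \<le> ?a * e n + h * d"
      by (intro step Suc.prems order_trans[OF IH bound[OF nT]])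
    also have "\<dots> \<le> ?a * (real n * h * d * ?a ^ n) + h * d * ?a ^ Suc n"
    proof -
      have "1 \<le> ?a ^ Suc n" using a by (rule one_le_power)
      then have "h * d * 1 \<le> h * d * ?a ^ Suc n" using h d by (intro mult_left_mono) auto
      then show ?thesis using IH a by (intro add_mono mult_left_mono) auto
    qed
    also have "\<dots> = real (Suc n) * h * d * ?a ^ Suc n" by (simp add: algebra_simps)
    finally show ?case .
  qed
  with bound[OF n] show ?thesis by linarith
qed

context regular_solution
begin

text \<open>
  The case \<open>\<alpha> = 0\<close> comes first: it keeps the error at orders \<open>s + 1\<close> and \<open>s\<close> at most \<open>1 / 2\<close>, hence
  the numerical stages in the ball of radius \<open>R\<close>. This is the regularity of the numerical
  solution that the error recursion for general \<open>\<alpha>\<close> needs.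
\<close>

lemma global_error:
  assumes h: "0 < h" "h \<le> 1" and \<alpha>: "-1 \<le> \<alpha>" "\<alpha> \<le> 1" and c: "1 \<le> c"
    and A0: "condition_A K h c 0 bbar1 b1" and A\<alpha>: "condition_A K h c \<alpha> bbar1 b1"
    and Z: "zero_frequency_limit c \<alpha> bbar1 b1"
    and small: "T * local_error_const s p R (c + 1) * exp (growth_const s p R (c + 1) * T) * h \<le> 1 / 2"
    and n: "real n * h \<le> T"
  shows "E (s - \<alpha>) (\<lambda>j. y (t0 + real n * h) j - fst (erkn K p bbar1 b1 h (y t0) (v t0) n) j)
      (\<lambda>j. v (t0 + real n * h) j - snd (erkn K p bbar1 b1 h (y t0) (v t0) n) j)
    \<le> T * (local_error_const s p R (c + 1) * h powr (1 + \<alpha>)) * exp (growth_const s p R (c + 1) * T)"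
proof -
  define L where "L = growth_const s p R (c + 1)"
  define d where "d = local_error_const s p R (c + 1)"
  define Y where "Y = erkn K p bbar1 b1 h (y t0) (v t0)"
  define e where "e \<gamma> n = E (s - \<gamma>) (\<lambda>j. y (t0 + real n * h) j - fst (Y n) j)
      (\<lambda>j. v (t0 + real n * h) j - snd (Y n) j)" for \<gamma> n
  have L0: "0 \<le> L" unfolding L_def growth_const_def using c G_ge_1 by simp
  have d0: "0 \<le> d" unfolding d_def local_error_const_def defect_const_def Let_def
    using c G_ge_1 R_ge_1 by simp
  have start: "e \<gamma> 0 \<le> 0" for \<gamma>
    by (simp add: e_def Y_def erkn_def energy_norm_def norm_new_def)
  have one_step: "e \<gamma> (Suc n) \<le> (1 + L * h) * e \<gamma> n + h * (d * h powr (1 + \<gamma>))"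
    if \<gamma>: "-1 \<le> \<gamma>" "\<gamma> \<le> 1" "condition_A K h c \<gamma> bbar1 b1" "zero_frequency_limit c \<gamma> bbar1 b1"
      and n: "real (Suc n) * h \<le> T" and small: "e 0 n \<le> 1 / 2" for \<gamma> n
  proof -
    have nh: "0 \<le> real n * h" "real n * h + h \<le> T" using h n by (auto simp: distrib_right)
    interpret regular_step K s p t0 T y v R "t0 + real n * h" h
      by unfold_locales (use h nh in auto)
    have next_time: "t0 + real (Suc n) * h = t0 + real n * h + h" by (simp add: distrib_right)
    have next_Y: "Y (Suc n) = erkn_step K p bbar1 b1 h (fst (Y n), snd (Y n))"
      by (simp add: Y_def erkn_def)
    show ?thesis
      unfolding e_def next_time next_Y L_def d_def
    proof (rule one_step_error[OF \<gamma>(1,2)])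
      show "mode_coefficients_bounded K h (c + 1) \<gamma>
          (\<lambda>j. bbar1 (h\<^sup>2 * (omega K j)\<^sup>2)) (\<lambda>j. b1 (h\<^sup>2 * (omega K j)\<^sup>2))"
        by (rule mode_coefficients_bounded_of_condition_A[OF h \<gamma>(1,2) c A0 \<gamma>(3,4)])
      show "N (s + 1) (erkn_half K h (fst (Y n)) (snd (Y n))) \<le> R"
        using small by (intro stage_le_of_small_error) (simp add: e_def)
    qed (use c in simp)
  qed
  have Z0: "zero_frequency_limit c 0 bbar1 b1" using Z by (simp add: zero_frequency_limit_def)
  have small_bound: "T * (d * h powr (1 + 0)) * exp (L * T) \<le> 1 / 2"
    using small h by (simp add: L_def d_def mult_ac)
  \<comment> \<open>Bootstrap: as long as the bound for \<open>\<alpha> = 0\<close> holds, the next step is admissible.\<close>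
  have e0: "e 0 n \<le> 1 / 2" if "real n * h \<le> T" for n
  proof -
    have "e 0 n \<le> T * (d * h powr (1 + 0)) * exp (L * T)"
    proof (rule discrete_gronwall[where e = "e 0", OF h(1) L0 _ start _ that])
      fix n assume "real (Suc n) * h \<le> T" "e 0 n \<le> T * (d * h powr (1 + 0)) * exp (L * T)"
      then show "e 0 (Suc n) \<le> (1 + L * h) * e 0 n + h * (d * h powr (1 + 0))"
        using small_bound by (intro one_step A0 Z0) auto
    qed (use d0 in simp)
    with small_bound show ?thesis by linarith
  qed
  have "e \<alpha> n \<le> T * (d * h powr (1 + \<alpha>)) * exp (L * T)"
  proof (rule discrete_gronwall[where e = "e \<alpha>", OF h(1) L0 _ start _ n])
    fix n assume n: "real (Suc n) * h \<le> T"
    then have "real n * h \<le> T" using h by (simp add: distrib_right)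
    from e0[OF this] show "e \<alpha> (Suc n) \<le> (1 + L * h) * e \<alpha> n + h * (d * h powr (1 + \<alpha>))"
      by (intro one_step \<alpha> A\<alpha> Z n)
  qed (use d0 in simp)
  then show ?thesis by (simp add: e_def Y_def L_def d_def)
qed

end

theorem theorem6p1:
  fixes M s T c :: real and p :: nat
  assumes "1 \<le> p" and "1 \<le> c" and "0 \<le> s"
  shows "\<exists>C h0 :: real. 0 < h0 \<and>
    (\<forall>(K :: nat) (\<alpha> :: real) (t0 :: real)
       (y :: real \<Rightarrow> int \<Rightarrow> complex) (v :: real \<Rightarrow> int \<Rightarrow> complex)
       (bbar1 :: real \<Rightarrow> real) (b1 :: real \<Rightarrow> real) (h :: real).
       1 \<le> K \<longrightarrow> -1 \<le> \<alpha> \<longrightarrow> \<alpha> \<le> 1 \<longrightarrow>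
       semidiscrete_solution K p t0 T y v \<longrightarrow>
       (\<forall>t. 0 \<le> t - t0 \<and> t - t0 \<le> T \<longrightarrow>
          norm_new K (s + 1) (y t) + norm_new K s (v t) \<le> M) \<longrightarrow>
       0 < h \<longrightarrow> h \<le> h0 \<longrightarrow>
       condition_A K h c 0 bbar1 b1 \<longrightarrow>
       condition_A K h c \<alpha> bbar1 b1 \<longrightarrow>
       zero_frequency_limit c \<alpha> bbar1 b1 \<longrightarrow>
       (\<forall>n :: nat. real n * h \<le> T \<longrightarrow>
          (let (yn, vn) = erkn K p bbar1 b1 h (y t0) (v t0) n in
             norm_new K (s + 1 - \<alpha>) (\<lambda>j. y (t0 + real n * h) j - yn j)
             + norm_new K (s - \<alpha>) (\<lambda>j. v (t0 + real n * h) j - vn j)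
             \<le> C * h powr (1 + \<alpha>))))"
proof -
  \<comment> \<open>The absolute value guards against a negative \<open>M\<close>, which can only occur if the time interval is empty.\<close>
  define R where "R = \<bar>M\<bar> + 1"
  define B where "B = T * local_error_const s p R (c + 1) * exp (growth_const s p R (c + 1) * T)"
  \<comment> \<open>This makes \<open>B * h\<close>, the error bound for \<open>\<alpha> = 0\<close>, at most \<open>1 / 2\<close>.\<close>
  define h0 where "h0 = min 1 (1 / (2 * (\<bar>B\<bar> + 1)))"
  have h0: "0 < h0" by (simp add: h0_def)
  show ?thesis
  proof (rule exI[of _ "2 * B"], rule exI[of _ h0], intro conjI h0 allI impI)
    fix K :: nat and \<alpha> t0 :: real and y v :: "real \<Rightarrow> int \<Rightarrow> complex"
      and bbar1 b1 :: "real \<Rightarrow> real" and h :: real and n :: nat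
    assume K: "1 \<le> K" and \<alpha>: "-1 \<le> \<alpha>" "\<alpha> \<le> 1" and sol: "semidiscrete_solution K p t0 T y v"
      and M: "\<forall>t. 0 \<le> t - t0 \<and> t - t0 \<le> T \<longrightarrow> norm_new K (s + 1) (y t) + norm_new K s (v t) \<le> M"
      and h: "0 < h" "h \<le> h0" and A: "condition_A K h c 0 bbar1 b1" "condition_A K h c \<alpha> bbar1 b1"
      and Z: "zero_frequency_limit c \<alpha> bbar1 b1" and n: "real n * h \<le> T"
    interpret regular_solution K s p t0 T y v R
    proof unfold_locales
      show "norm_new K (s + 1) (y t) + norm_new K s (v t) \<le> R - 1" if "t \<in> {t0..t0 + T}" for t
        using M[rule_format, of t] that by (auto simp: R_def)
    qed (use K sol assms in \<open>auto simp: R_def\<close>)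
    have h1: "h \<le> 1" and hB: "h \<le> 1 / (2 * (\<bar>B\<bar> + 1))"
      using h(2) min.cobounded1[of 1 "1 / (2 * (\<bar>B\<bar> + 1))"] min.cobounded2[of 1 "1 / (2 * (\<bar>B\<bar> + 1))"]
      unfolding h0_def by linarith+
    have "B * h \<le> (\<bar>B\<bar> + 1) * (1 / (2 * (\<bar>B\<bar> + 1)))"
      using h hB by (intro mult_mono) auto
    also have "\<dots> = 1 / 2" by (simp add: field_simps)
    finally have small: "B * h \<le> 1 / 2" .
    obtain yn vn where Y: "erkn K p bbar1 b1 h (y t0) (v t0) n = (yn, vn)" by fastforce
    let ?e = "\<lambda>j. y (t0 + real n * h) j - yn j" and ?e' = "\<lambda>j. v (t0 + real n * h) j - vn j"
    have "E (s - \<alpha>) ?e ?e' \<le> B * h powr (1 + \<alpha>)"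
      using global_error[OF h(1) h1 \<alpha> assms(2) A Z small[unfolded B_def] n]
      by (simp add: Y B_def mult_ac)
    then have "N (s - \<alpha> + 1) ?e + N (s - \<alpha>) ?e' \<le> 2 * B * h powr (1 + \<alpha>)"
      using norm_new_le_energy_norm(1)[of "s - \<alpha>" ?e ?e'] norm_new_le_energy_norm(2)[of "s - \<alpha>" ?e' ?e]
      by linarith
    then show "let (yn, vn) = erkn K p bbar1 b1 h (y t0) (v t0) n in
        N (s + 1 - \<alpha>) (\<lambda>j. y (t0 + real n * h) j - yn j)
        + N (s - \<alpha>) (\<lambda>j. v (t0 + real n * h) j - vn j) \<le> 2 * B * h powr (1 + \<alpha>)"
      by (simp add: Y algebra_simps)
  qed
qed

end
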